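(* Let $\rho\in\mathcal P^\infty_+(M)$, let $V_\rho$ be a real Hilbert space continuously embedded in the distributional vector fields on $M$ such that $A_\rho:V_\rho\to\mathcal D'(M)$, $A_\rho v=-\operatorname{div}(\rho v)$, is continuous, and let $\mathcal C_\rho$ be a linear class of regular covectors such that $v\mapsto\int_M\rho\langle\operatorname{grad}f,v\rangle_g\,d\mathrm{vol}$ is continuous on $V_\rho$ for every $f\in\mathcal C_\rho$. Let $N_\rho,H_\rho,T_{\rho,V},B_\rho$ and $K_\rho=A_\rho B_\rho$ be as defined in the context. Then the form $$\langle f,h\rangle_{T^*_{\rho,V}}=\langle B_\rho f,B_\rho h\rangle_{V_\rho}$$ is positive semidefinite on $\mathcal C_\rho$. Quotienting by $\ker B_\rho$ and completing gives a Hilbert space $T^*_{\rho,V}$. The operator $K_\rho$ extends uniquely to an isometric isomorphism $$K_\rho:T^*_{\rho,V}\to A_\rho\,\overline{B_\rho(\mathcal C_\rho)}^{\,V_\rho}\subseteq T_{\rho,V}.$$ Regular covectors $f,h\in\mathcal C_\rho$ satisfy $\langle f,K_\rho h\rangle=\langle B_\rho f,B_\rho h\rangle_{V_\rho}$. If the only $w\in H_\rho$ satisfying $\int_M\rho\langle\operatorname{grad}f,w\rangle_g\,d\mathrm{vol}=0$ for every $f\in\mathcal C_\rho$ is $w=0$, then $B_\rho(\mathcal C_\rho)$ is dense in $H_\rho$ and $K_\rho$ is onto the full space $T_{\rho,V}$.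
   Context: $M$ is a connected, closed, oriented Riemannian manifold with metric $g$ and volume $\mathrm{vol}$; $\mathcal P^\infty_+(M)$ is the set of smooth strictly positive functions $\rho$ with $\int_M\rho\,d\mathrm{vol}=1$. A regular covector is a smooth function $f$ modulo constants; integrals against distributional fields denote the distributional pairing, and $\langle f,\sigma\rangle=\int_M f\sigma\,d\mathrm{vol}$ is the pairing of $f$ with the distribution $\sigma$, so that $\langle f,A_\rho v\rangle=\int_M\rho\langle\operatorname{grad}f,v\rangle_g\,d\mathrm{vol}$. Define $N_\rho=\ker A_\rho\subset V_\rho$, $H_\rho=N_\rho^\perp$ (orthogonal complement in $V_\rho$), and $T_{\rho,V}=A_\rho(V_\rho)$ with the quotient norm $\|\sigma\|_{T_{\rho,V}}=\inf\{\|v\|_{V_\rho}:v\in V_\rho,\ A_\rho v=\sigma\}$. For $f\in\mathcal C_\rho$, $B_\rho f\in V_\rho$ is the unique Riesz representative with $\langle B_\rho f,v\rangle_{V_\rho}=\int_M\rho\langle\operatorname{grad}f,v\rangle_g\,d\mathrm{vol}$ for all $v\in V_\rho$, and $K_\rho f=A_\rho B_\rho f$. *)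

theory Defs
  imports "HOL-Analysis.Analysis"
begin

section \<open>Closed oriented Riemannian manifolds\<close>

text \<open>
  The manifold is the whole type \<open>'m\<close>, of dimension \<open>CARD('n)\<close>.  Its oriented smooth structure is
  given by a (not necessarily maximal) oriented atlas, a set of pairs of a domain and a coordinate
  map.  Coordinate maps and metrics are total functions; their values outside the chart domains,
  or on arguments that are not tangent vectors, are irrelevant.
\<close>

type_synonym ('m, 'n) chart = "'m set \<times> ('m \<Rightarrow> real ^ 'n)"

primrec iterated_partial :: "'n::finite list \<Rightarrow> (real ^ 'n \<Rightarrow> real) \<Rightarrow> real ^ 'n \<Rightarrow> real" where
  "iterated_partial [] f = f"
| "iterated_partial (i # is) f =
     (\<lambda>x. frechet_derivative (iterated_partial is f) (at x) (axis i 1))"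

text \<open>Used for open \<open>W\<close> only.\<close>

definition smooth_on :: "(real ^ 'n::finite) set \<Rightarrow> (real ^ 'n \<Rightarrow> real) \<Rightarrow> bool" where
  "smooth_on W f \<longleftrightarrow> (\<forall>is. iterated_partial is f differentiable_on W)"

definition is_chart :: "('m::topological_space, 'n::finite) chart \<Rightarrow> bool" where
  "is_chart c \<longleftrightarrow> open (fst c) \<and> open (snd c ` fst c) \<and>
     (\<exists>\<psi>. homeomorphism (fst c) (snd c ` fst c) (snd c) \<psi>)"

definition chart_inv :: "('m, 'n) chart \<Rightarrow> real ^ 'n \<Rightarrow> 'm" where
  "chart_inv c = inv_into (fst c) (snd c)"

definition oriented_atlas :: "('m::topological_space, 'n::finite) chart set \<Rightarrow> bool" where
  "oriented_atlas At \<longleftrightarrow>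
     (\<forall>c\<in>At. is_chart c) \<and> (\<Union>c\<in>At. fst c) = UNIV \<and>
     (\<forall>c\<in>At. \<forall>c'\<in>At.
        (\<forall>i. smooth_on (snd c ` (fst c \<inter> fst c')) (\<lambda>x. snd c' (chart_inv c x) $ i)) \<and>
        (\<forall>x \<in> snd c ` (fst c \<inter> fst c'). 0 < det (jacobian (snd c' \<circ> chart_inv c) (at x))))"

definition smooth_functions :: "('m, 'n::finite) chart set \<Rightarrow> ('m \<Rightarrow> real) set" where
  "smooth_functions At = {f. \<forall>c\<in>At. smooth_on (snd c ` fst c) (f \<circ> chart_inv c)}"

text \<open>
  Tangent vectors at \<open>p\<close> are derivations at \<open>p\<close> of the algebra of smooth functions.  Requiring the
  value 0 off this algebra makes them elements of a space of total functions with pointwise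
  operations.  The same convention is used for distributions.
\<close>

type_synonym 'm tangent = "('m \<Rightarrow> real) \<Rightarrow> real"

definition tangent_space :: "('m, 'n::finite) chart set \<Rightarrow> 'm \<Rightarrow> 'm tangent set" where
  "tangent_space At p =
     {\<delta>. (\<forall>f. f \<notin> smooth_functions At \<longrightarrow> \<delta> f = 0) \<and>
         (\<forall>f\<in>smooth_functions At. \<forall>h\<in>smooth_functions At. \<forall>a b.
            \<delta> (\<lambda>x. a * f x + b * h x) = a * \<delta> f + b * \<delta> h) \<and>
         (\<forall>f\<in>smooth_functions At. \<forall>h\<in>smooth_functions At.
            \<delta> (\<lambda>x. f x * h x) = f p * \<delta> h + \<delta> f * h p)}"

text \<open>The tangent vector at \<open>p\<close> with coordinate vector \<open>a\<close> in the chart \<open>c\<close>, and conversely.\<close>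

definition chart_vector ::
    "('m, 'n::finite) chart set \<Rightarrow> ('m, 'n) chart \<Rightarrow> 'm \<Rightarrow> real ^ 'n \<Rightarrow> 'm tangent" where
  "chart_vector At c p a =
     (\<lambda>f. if f \<in> smooth_functions At
          then frechet_derivative (f \<circ> chart_inv c) (at (snd c p)) a else 0)"

definition chart_components ::
    "('m, 'n::finite) chart set \<Rightarrow> ('m, 'n) chart \<Rightarrow> 'm \<Rightarrow> 'm tangent \<Rightarrow> real ^ 'n" where
  "chart_components At c p \<delta> = (THE a. \<delta> = chart_vector At c p a)"

type_synonym 'm field = "'m \<Rightarrow> 'm tangent"

definition field_component ::
    "('m, 'n::finite) chart set \<Rightarrow> ('m, 'n) chart \<Rightarrow> 'm field \<Rightarrow> 'n \<Rightarrow> real ^ 'n \<Rightarrow> real" where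
  "field_component At c X i =
     (\<lambda>x. chart_components At c (chart_inv c x) (X (chart_inv c x)) $ i)"

definition smooth_fields :: "('m, 'n::finite) chart set \<Rightarrow> 'm field set" where
  "smooth_fields At =
     {X. (\<forall>p. X p \<in> tangent_space At p) \<and>
         (\<forall>c\<in>At. \<forall>i. smooth_on (snd c ` fst c) (field_component At c X i))}"

type_synonym 'm metric_tensor = "'m \<Rightarrow> 'm tangent \<Rightarrow> 'm tangent \<Rightarrow> real"

definition metric_matrix ::
    "('m, 'n::finite) chart set \<Rightarrow> 'm metric_tensor \<Rightarrow> ('m, 'n) chart \<Rightarrow> real ^ 'n \<Rightarrow> real ^ 'n ^ 'n"
where
  "metric_matrix At g c x =
     (\<chi> i j. g (chart_inv c x) (chart_vector At c (chart_inv c x) (axis i 1))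
                              (chart_vector At c (chart_inv c x) (axis j 1)))"

definition riemannian_metric :: "('m, 'n::finite) chart set \<Rightarrow> 'm metric_tensor \<Rightarrow> bool" where
  "riemannian_metric At g \<longleftrightarrow>
     (\<forall>p. \<forall>u\<in>tangent_space At p. \<forall>v\<in>tangent_space At p.
        g p u v = g p v u \<and>
        (\<forall>w\<in>tangent_space At p. \<forall>a b.
           g p (\<lambda>f. a * u f + b * v f) w = a * g p u w + b * g p v w)) \<and>
     (\<forall>p. \<forall>u\<in>tangent_space At p. u \<noteq> (\<lambda>_. 0) \<longrightarrow> 0 < g p u u) \<and>
     (\<forall>c\<in>At. \<forall>i j. smooth_on (snd c ` fst c) (\<lambda>x. metric_matrix At g c x $ i $ j))"

definition closed_oriented_riemannian_manifold ::
    "('m::{t2_space, second_countable_topology}, 'n::finite) chart set \<Rightarrow> 'm metric_tensor \<Rightarrow> bool"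
where
  "closed_oriented_riemannian_manifold At g \<longleftrightarrow>
     compact (UNIV :: 'm set) \<and> connected (UNIV :: 'm set) \<and>
     oriented_atlas At \<and> riemannian_metric At g"

definition riemannian_volume ::
    "('m::topological_space, 'n::finite) chart set \<Rightarrow> 'm metric_tensor \<Rightarrow> 'm measure" where
  "riemannian_volume At g =
     (THE \<mu>. sets \<mu> = sets borel \<and>
        (\<forall>c\<in>At. \<forall>S\<in>sets borel. S \<subseteq> fst c \<longrightarrow>
           emeasure \<mu> S =
             (\<integral>\<^sup>+x\<in>snd c ` S. ennreal (sqrt (det (metric_matrix At g c x))) \<partial>lborel)))"

definition smooth_positive_densities ::
    "('m::topological_space, 'n::finite) chart set \<Rightarrow> 'm metric_tensor \<Rightarrow> ('m \<Rightarrow> real) set" where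
  "smooth_positive_densities At g =
     {\<rho>\<in>smooth_functions At. (\<forall>x. 0 < \<rho> x) \<and> integral\<^sup>L (riemannian_volume At g) \<rho> = 1}"

definition gradient ::
    "('m, 'n::finite) chart set \<Rightarrow> 'm metric_tensor \<Rightarrow> ('m \<Rightarrow> real) \<Rightarrow> 'm field" where
  "gradient At g f =
     (\<lambda>p. THE w. w \<in> tangent_space At p \<and> (\<forall>u\<in>tangent_space At p. g p w u = u f))"


section \<open>Distributions and distributional vector fields\<close>

text \<open>
  The test spaces carry the \<open>C\<^sup>\<infinity>\<close> topology: uniform convergence on compact subsets of the chart
  images of all iterated partial derivatives.  It is metrizable, so that continuity of functionals
  can be stated with sequences.
\<close>

definition smooth_converges ::
    "(real ^ 'n::finite) set \<Rightarrow> (nat \<Rightarrow> real ^ 'n \<Rightarrow> real) \<Rightarrow> (real ^ 'n \<Rightarrow> real) \<Rightarrow> bool" where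
  "smooth_converges W F f \<longleftrightarrow>
     (\<forall>K is. compact K \<and> K \<subseteq> W \<longrightarrow>
        uniform_limit K (\<lambda>n. iterated_partial is (F n)) (iterated_partial is f) sequentially)"

definition function_converges ::
    "('m, 'n::finite) chart set \<Rightarrow> (nat \<Rightarrow> 'm \<Rightarrow> real) \<Rightarrow> ('m \<Rightarrow> real) \<Rightarrow> bool" where
  "function_converges At F f \<longleftrightarrow>
     (\<forall>c\<in>At. smooth_converges (snd c ` fst c) (\<lambda>n. F n \<circ> chart_inv c) (f \<circ> chart_inv c))"

definition field_converges ::
    "('m, 'n::finite) chart set \<Rightarrow> (nat \<Rightarrow> 'm field) \<Rightarrow> 'm field \<Rightarrow> bool" where
  "field_converges At F X \<longleftrightarrow>
     (\<forall>c\<in>At. \<forall>i. smooth_converges (snd c ` fst c)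
        (\<lambda>n. field_component At c (F n) i) (field_component At c X i))"

type_synonym 'm dist = "('m \<Rightarrow> real) \<Rightarrow> real"

definition distributions :: "('m, 'n::finite) chart set \<Rightarrow> 'm dist set" where
  "distributions At =
     {\<sigma>. (\<forall>f. f \<notin> smooth_functions At \<longrightarrow> \<sigma> f = 0) \<and>
         (\<forall>f\<in>smooth_functions At. \<forall>h\<in>smooth_functions At. \<forall>a b.
            \<sigma> (\<lambda>x. a * f x + b * h x) = a * \<sigma> f + b * \<sigma> h) \<and>
         (\<forall>F f. (\<forall>n. F n \<in> smooth_functions At) \<and> f \<in> smooth_functions At \<and>
            function_converges At F f \<longrightarrow> (\<lambda>n. \<sigma> (F n)) \<longlonglongrightarrow> \<sigma> f)}"

text \<open>
  A smooth vector field \<open>Y\<close> is identified with the functional mapping a smooth vector field \<open>X\<close> to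
  the integral of \<open>\<lambda>p. g p Y\<^sub>p X\<^sub>p\<close> against the Riemannian volume.  Accordingly the value \<open>T X\<close> of
  a distributional vector field is the distributional reading of that integral for \<open>T\<close> in place of
  \<open>Y\<close>.
\<close>

type_synonym 'm dist_field = "'m field \<Rightarrow> real"

definition distributional_fields :: "('m, 'n::finite) chart set \<Rightarrow> 'm dist_field set" where
  "distributional_fields At =
     {T. (\<forall>X. X \<notin> smooth_fields At \<longrightarrow> T X = 0) \<and>
         (\<forall>X\<in>smooth_fields At. \<forall>Y\<in>smooth_fields At. \<forall>a b.
            T (\<lambda>p f. a * X p f + b * Y p f) = a * T X + b * T Y) \<and>
         (\<forall>F X. (\<forall>n. F n \<in> smooth_fields At) \<and> X \<in> smooth_fields At \<and>
            field_converges At F X \<longrightarrow> (\<lambda>n. T (F n)) \<longlonglongrightarrow> T X)}"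

definition field_mult :: "('m \<Rightarrow> real) \<Rightarrow> 'm dist_field \<Rightarrow> 'm dist_field" where
  "field_mult \<rho> T = (\<lambda>X. T (\<lambda>p f. \<rho> p * X p f))"

definition divergence ::
    "('m, 'n::finite) chart set \<Rightarrow> 'm metric_tensor \<Rightarrow> 'm dist_field \<Rightarrow> 'm dist" where
  "divergence At g T = (\<lambda>f. if f \<in> smooth_functions At then - T (gradient At g f) else 0)"

text \<open>The integral of \<open>\<rho> \<langle>grad f, T\<rangle>\<close> against the Riemannian volume, read as a pairing.\<close>

definition weighted_pairing ::
    "('m, 'n::finite) chart set \<Rightarrow> 'm metric_tensor \<Rightarrow> ('m \<Rightarrow> real) \<Rightarrow> ('m \<Rightarrow> real) \<Rightarrow>
     'm dist_field \<Rightarrow> real" where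
  "weighted_pairing At g \<rho> f T = T (\<lambda>p h. \<rho> p * gradient At g f p h)"

text \<open>
  The space \<open>'m dist\<close> and \<open>'m dist_field\<close> carry the library's topology of pointwise convergence,
  which is the weak-* topology on functionals.  For a linear map from a Hilbert space, continuity
  into the weak-* and into the strong dual topology agree, the test spaces being Frechet spaces.
\<close>

definition hilbert_space_of_fields ::
    "('m, 'n::finite) chart set \<Rightarrow> ('v::{real_inner, complete_space} \<Rightarrow> 'm dist_field) \<Rightarrow> bool"
where
  "hilbert_space_of_fields At \<iota> \<longleftrightarrow>
     (\<forall>v. \<iota> v \<in> distributional_fields At) \<and>
     (\<forall>v w a b. \<iota> (a *\<^sub>R v + b *\<^sub>R w) = (\<lambda>X. a * \<iota> v X + b * \<iota> w X)) \<and>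
     inj \<iota> \<and> continuous_on UNIV \<iota>"

definition continuity_operator ::
    "('m, 'n::finite) chart set \<Rightarrow> 'm metric_tensor \<Rightarrow> ('m \<Rightarrow> real) \<Rightarrow> ('v \<Rightarrow> 'm dist_field) \<Rightarrow>
     'v \<Rightarrow> 'm dist" where
  "continuity_operator At g \<rho> \<iota> v = (\<lambda>f. - divergence At g (field_mult \<rho> (\<iota> v)) f)"


section \<open>Inner product spaces on a carrier set, quotients and completion\<close>

record 'a vspace =
  vcarrier :: "'a set"
  vzero :: 'a
  vadd :: "'a \<Rightarrow> 'a \<Rightarrow> 'a"
  vscale :: "real \<Rightarrow> 'a \<Rightarrow> 'a"

record 'a form_space = "'a vspace" +
  vform :: "'a \<Rightarrow> 'a \<Rightarrow> real"

definition vector_space_axioms :: "('a, 'z) vspace_scheme \<Rightarrow> bool" where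
  "vector_space_axioms S \<longleftrightarrow>
     vzero S \<in> vcarrier S \<and>
     (\<forall>x\<in>vcarrier S. \<forall>y\<in>vcarrier S. vadd S x y \<in> vcarrier S) \<and>
     (\<forall>a. \<forall>x\<in>vcarrier S. vscale S a x \<in> vcarrier S) \<and>
     (\<forall>x\<in>vcarrier S. \<forall>y\<in>vcarrier S. \<forall>z\<in>vcarrier S.
        vadd S (vadd S x y) z = vadd S x (vadd S y z)) \<and>
     (\<forall>x\<in>vcarrier S. \<forall>y\<in>vcarrier S. vadd S x y = vadd S y x) \<and>
     (\<forall>x\<in>vcarrier S. vadd S (vzero S) x = x) \<and>
     (\<forall>x\<in>vcarrier S. vadd S x (vscale S (- 1) x) = vzero S) \<and>
     (\<forall>a. \<forall>x\<in>vcarrier S. \<forall>y\<in>vcarrier S.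
        vscale S a (vadd S x y) = vadd S (vscale S a x) (vscale S a y)) \<and>
     (\<forall>a b. \<forall>x\<in>vcarrier S.
        vscale S (a + b) x = vadd S (vscale S a x) (vscale S b x) \<and>
        vscale S a (vscale S b x) = vscale S (a * b) x) \<and>
     (\<forall>x\<in>vcarrier S. vscale S 1 x = x)"

definition linear_subspace :: "('a, 'z) vspace_scheme \<Rightarrow> 'a set \<Rightarrow> bool" where
  "linear_subspace S N \<longleftrightarrow>
     N \<subseteq> vcarrier S \<and> vzero S \<in> N \<and>
     (\<forall>x\<in>N. \<forall>y\<in>N. vadd S x y \<in> N) \<and> (\<forall>a. \<forall>x\<in>N. vscale S a x \<in> N)"

definition positive_semidefinite_form :: "('a, 'z) form_space_scheme \<Rightarrow> bool" where
  "positive_semidefinite_form S \<longleftrightarrow>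
     (\<forall>x\<in>vcarrier S. \<forall>y\<in>vcarrier S. vform S x y = vform S y x) \<and>
     (\<forall>x\<in>vcarrier S. \<forall>y\<in>vcarrier S. \<forall>z\<in>vcarrier S.
        vform S (vadd S x y) z = vform S x z + vform S y z) \<and>
     (\<forall>a. \<forall>x\<in>vcarrier S. \<forall>y\<in>vcarrier S. vform S (vscale S a x) y = a * vform S x y) \<and>
     (\<forall>x\<in>vcarrier S. 0 \<le> vform S x x)"

definition form_norm :: "('a, 'z) form_space_scheme \<Rightarrow> 'a \<Rightarrow> real" where
  "form_norm S x = sqrt (vform S x x)"

text \<open>The case distinction is there because \<open>Metric_space\<close> wants a total nonnegative distance.\<close>

definition form_dist :: "('a, 'z) form_space_scheme \<Rightarrow> 'a \<Rightarrow> 'a \<Rightarrow> real" where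
  "form_dist S x y =
     (if x \<in> vcarrier S \<and> y \<in> vcarrier S then form_norm S (vadd S x (vscale S (- 1) y)) else 0)"

definition is_hilbert_space :: "('a, 'z) form_space_scheme \<Rightarrow> bool" where
  "is_hilbert_space S \<longleftrightarrow>
     vector_space_axioms S \<and> positive_semidefinite_form S \<and>
     (\<forall>x\<in>vcarrier S. vform S x x = 0 \<longrightarrow> x = vzero S) \<and>
     Metric_space.mcomplete (vcarrier S) (form_dist S)"

definition coset :: "('a, 'z) vspace_scheme \<Rightarrow> 'a set \<Rightarrow> 'a \<Rightarrow> 'a set" where
  "coset S N x = {vadd S x k | k. k \<in> N}"

definition quotient_vspace :: "('a, 'z) vspace_scheme \<Rightarrow> 'a set \<Rightarrow> 'a set vspace" where
  "quotient_vspace S N =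
     \<lparr> vcarrier = coset S N ` vcarrier S,
       vzero = N,
       vadd = (\<lambda>P Q. {vadd S x y | x y. x \<in> P \<and> y \<in> Q}),
       vscale = (\<lambda>a P. {vadd S (vscale S a x) k | x k. x \<in> P \<and> k \<in> N}) \<rparr>"

definition with_form :: "'a vspace \<Rightarrow> ('a \<Rightarrow> 'a \<Rightarrow> real) \<Rightarrow> 'a form_space" where
  "with_form S q = vspace.extend S (form_space.fields q)"

text \<open>Only for subspaces \<open>N\<close> on which the form vanishes, so that representatives do not matter.\<close>

definition quotient_form_space :: "('a, 'z) form_space_scheme \<Rightarrow> 'a set \<Rightarrow> 'a set form_space" where
  "quotient_form_space S N =
     with_form (quotient_vspace S N) (\<lambda>P Q. vform S (SOME x. x \<in> P) (SOME y. y \<in> Q))"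

text \<open>The completion consists of the classes of Cauchy sequences modulo null sequences.\<close>

definition cauchy_sequences :: "('a, 'z) form_space_scheme \<Rightarrow> (nat \<Rightarrow> 'a) set" where
  "cauchy_sequences S = {s. Metric_space.MCauchy (vcarrier S) (form_dist S) s}"

definition cauchy_class :: "('a, 'z) form_space_scheme \<Rightarrow> (nat \<Rightarrow> 'a) \<Rightarrow> (nat \<Rightarrow> 'a) set" where
  "cauchy_class S s = {t \<in> cauchy_sequences S. (\<lambda>n. form_dist S (s n) (t n)) \<longlonglongrightarrow> 0}"

definition completion :: "('a, 'z) form_space_scheme \<Rightarrow> (nat \<Rightarrow> 'a) set form_space" where
  "completion S =
     \<lparr> vcarrier = cauchy_class S ` cauchy_sequences S,
       vzero = cauchy_class S (\<lambda>_. vzero S),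
       vadd = (\<lambda>P Q. cauchy_class S (\<lambda>n. vadd S ((SOME s. s \<in> P) n) ((SOME t. t \<in> Q) n))),
       vscale = (\<lambda>a P. cauchy_class S (\<lambda>n. vscale S a ((SOME s. s \<in> P) n))),
       vform = (\<lambda>P Q. lim (\<lambda>n. vform S ((SOME s. s \<in> P) n) ((SOME t. t \<in> Q) n))) \<rparr>"

definition completion_embed :: "('a, 'z) form_space_scheme \<Rightarrow> 'a \<Rightarrow> (nat \<Rightarrow> 'a) set" where
  "completion_embed S x = cauchy_class S (\<lambda>_. x)"


section \<open>Covectors and the tangent and cotangent Hilbert spaces\<close>

definition smooth_function_space :: "('m, 'n::finite) chart set \<Rightarrow> ('m \<Rightarrow> real) vspace" where
  "smooth_function_space At =
     \<lparr> vcarrier = smooth_functions At,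
       vzero = (\<lambda>_. 0),
       vadd = (\<lambda>f h x. f x + h x),
       vscale = (\<lambda>a f x. a * f x) \<rparr>"

type_synonym 'm covector = "('m \<Rightarrow> real) set"

definition regular_covectors :: "('m, 'n::finite) chart set \<Rightarrow> 'm covector vspace" where
  "regular_covectors At = quotient_vspace (smooth_function_space At) {\<lambda>_. c | c. True}"

definition kernel_space :: "('v::real_inner \<Rightarrow> 'm dist) \<Rightarrow> 'v set" where
  "kernel_space A = {v. A v = (\<lambda>_. 0)}"

definition horizontal_space :: "('v::real_inner \<Rightarrow> 'm dist) \<Rightarrow> 'v set" where
  "horizontal_space A = (kernel_space A)\<^sup>\<bottom>"

definition tangent_norm :: "('v::real_inner \<Rightarrow> 'm dist) \<Rightarrow> 'm dist \<Rightarrow> real" where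
  "tangent_norm A \<sigma> = Inf {norm v | v. A v = \<sigma>}"

definition riesz_representative ::
    "('m, 'n::finite) chart set \<Rightarrow> 'm metric_tensor \<Rightarrow> ('m \<Rightarrow> real) \<Rightarrow>
     ('v::real_inner \<Rightarrow> 'm dist_field) \<Rightarrow> 'm covector \<Rightarrow> 'v" where
  "riesz_representative At g \<rho> \<iota> f =
     (THE b. \<forall>\<phi>\<in>f. \<forall>v. inner b v = weighted_pairing At g \<rho> \<phi> (\<iota> v))"

definition covector_form_space ::
    "('m, 'n::finite) chart set \<Rightarrow> 'm covector set \<Rightarrow> ('m covector \<Rightarrow> 'v::real_inner) \<Rightarrow>
     'm covector form_space" where
  "covector_form_space At C B =
     with_form ((regular_covectors At)\<lparr>vcarrier := C\<rparr>) (\<lambda>f h. inner (B f) (B h))"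

definition form_kernel :: "'m covector set \<Rightarrow> ('m covector \<Rightarrow> 'v::real_inner) \<Rightarrow> 'm covector set"
where
  "form_kernel C B = {f\<in>C. B f = 0}"

definition covector_quotient ::
    "('m, 'n::finite) chart set \<Rightarrow> 'm covector set \<Rightarrow> ('m covector \<Rightarrow> 'v::real_inner) \<Rightarrow>
     'm covector set form_space" where
  "covector_quotient At C B = quotient_form_space (covector_form_space At C B) (form_kernel C B)"

definition cotangent_space ::
    "('m, 'n::finite) chart set \<Rightarrow> 'm covector set \<Rightarrow> ('m covector \<Rightarrow> 'v::real_inner) \<Rightarrow>
     (nat \<Rightarrow> 'm covector set) set form_space" where
  "cotangent_space At C B = completion (covector_quotient At C B)"

definition covector_embed ::
    "('m, 'n::finite) chart set \<Rightarrow> 'm covector set \<Rightarrow> ('m covector \<Rightarrow> 'v::real_inner) \<Rightarrow>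
     'm covector \<Rightarrow> (nat \<Rightarrow> 'm covector set) set" where
  "covector_embed At C B f =
     completion_embed (covector_quotient At C B)
       (coset (covector_form_space At C B) (form_kernel C B) f)"

text \<open>Linear isometric bijections of \<open>S\<close> onto a set \<open>R\<close> of distributions with norm \<open>\<nu>\<close>.\<close>

definition isometric_isomorphism ::
    "('a, 'z) form_space_scheme \<Rightarrow> 'm dist set \<Rightarrow> ('m dist \<Rightarrow> real) \<Rightarrow> ('a \<Rightarrow> 'm dist) \<Rightarrow> bool" where
  "isometric_isomorphism S R \<nu> L \<longleftrightarrow>
     bij_betw L (vcarrier S) R \<and>
     (\<forall>x\<in>vcarrier S. \<forall>y\<in>vcarrier S. L (vadd S x y) = (\<lambda>\<phi>. L x \<phi> + L y \<phi>)) \<and>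
     (\<forall>a. \<forall>x\<in>vcarrier S. L (vscale S a x) = (\<lambda>\<phi>. a * L x \<phi>)) \<and>
     (\<forall>x\<in>vcarrier S. \<nu> (L x) = form_norm S x)"

end

theory Submission
  imports Defs
begin

text \<open>
  Everything follows from one identity: on smooth \<open>\<phi>\<close>, the distribution \<open>A v\<close> takes as its value the
  weighted pairing of \<open>\<phi>\<close> with \<open>v\<close>, so that the Riesz representative satisfies
  \<open>inner (B f) v = A v \<phi>\<close> for every representative \<open>\<phi>\<close> of the covector \<open>f\<close>.  Taking \<open>v = B h\<close> gives
  the formula for \<open>\<langle>f, K h\<rangle>\<close>; taking \<open>v\<close> in the kernel of \<open>A\<close> shows that \<open>B\<close> has horizontal values;
  and linearity of \<open>A v\<close> in \<open>\<phi>\<close> makes \<open>B\<close> linear (\<open>riesz_isometric_linear_map\<close>).  The geometry enters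
  only here: constants have zero gradient, so the pairing depends on the covector alone, and
  smooth functions form a vector space.

  The form on covectors is the pullback of the inner product along \<open>B\<close>, hence positive semidefinite.
  Dividing by its kernel makes the induced map injective, and the completion by classes of Cauchy
  sequences is identified with \<open>closure (B ` C)\<close> by sending a class to the limit of the images
  (\<open>quotient_isometric_linear_map\<close>, \<open>completion_isometric_linear_map\<close>, \<open>map_on_completion_image\<close>).  A
  space with a linear isometric bijection onto a closed subspace of a Hilbert space is a Hilbert space.

  On the orthogonal complement of its kernel \<open>A\<close> is injective and carries the norm to the quotient
  norm, since the horizontal preimage is the shortest one.  Composing \<open>A\<close> with the identification of
  the completion with \<open>closure (B ` C)\<close> therefore gives the isometric isomorphism
  (\<open>horizontal_isometric_isomorphism\<close>), which is unique because the covectors are dense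
  (\<open>isometric_isomorphism_unique\<close>).  If no nonzero horizontal vector annihilates all of \<open>C\<close>, then
  orthogonal projection shows that \<open>closure (B ` C)\<close> is the whole horizontal space, and a second
  projection, onto the closed kernel, shows that \<open>A\<close> maps the horizontal space onto its range.
\<close>

section \<open>Orthogonal projection and Riesz representation\<close>

text \<open>
  A minimizing sequence for the distance from \<open>x\<close> to \<open>S\<close> is Cauchy by the parallelogram law, because
  midpoints stay in \<open>S\<close>.  At the minimizer the first variation in every direction of \<open>S\<close> vanishes.
  This replaces the compactness used for closest points in Euclidean spaces.
\<close>

lemma orthogonal_projection_exists:
  fixes S :: "'v::{real_inner, complete_space} set"
  assumes sub: "subspace S" and cl: "closed S"
  obtains y where "y \<in> S" "x - y \<in> S\<^sup>\<bottom>"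
proof -
  define D where "D = Inf ((\<lambda>y. (norm (x - y))\<^sup>2) ` S)"
  have ne: "(\<lambda>y. (norm (x - y))\<^sup>2) ` S \<noteq> {}"
    using subspace_0[OF sub] by blast
  have bd: "bdd_below ((\<lambda>y. (norm (x - y))\<^sup>2) ` S)"
    by (rule bdd_belowI[of _ 0]) auto
  have low: "D \<le> (norm (x - y))\<^sup>2" if "y \<in> S" for y
    unfolding D_def using that bd by (intro cInf_lower) auto
  have "\<exists>y\<in>S. (norm (x - y))\<^sup>2 < D + e" if "e > 0" for e
    using cInf_less_iff[OF ne bd, of "D + e"] that unfolding D_def by auto
  then have "\<forall>n. \<exists>y\<in>S. (norm (x - y))\<^sup>2 < D + 1 / real (Suc n)"
    by simp
  then obtain y where yS: "\<And>n. y n \<in> S" and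
      yD: "\<And>n. (norm (x - y n))\<^sup>2 < D + 1 / real (Suc n)"
    by metis
  \<comment> \<open>The parallelogram law for \<open>x - p\<close> and \<open>x - q\<close>, with the midpoint at distance at least \<open>sqrt D\<close>.\<close>
  have para: "(norm (p - q))\<^sup>2 \<le> 2 * ((norm (x - p))\<^sup>2 - D) + 2 * ((norm (x - q))\<^sup>2 - D)"
    if "p \<in> S" "q \<in> S" for p q
  proof -
    have "(1/2) *\<^sub>R (p + q) \<in> S"
      using that sub by (simp add: subspace_add subspace_scale)
    then have "D \<le> (norm (x - (1/2) *\<^sub>R (p + q)))\<^sup>2"
      by (rule low)
    moreover have "(norm (p - q))\<^sup>2 = 2 * (norm (x - p))\<^sup>2 + 2 * (norm (x - q))\<^sup>2
        - 4 * (norm (x - (1/2) *\<^sub>R (p + q)))\<^sup>2"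
      by (simp add: power2_norm_eq_inner inner_diff_left inner_diff_right inner_add_left
          inner_add_right inner_commute algebra_simps)
    ultimately show ?thesis
      by simp
  qed
  have "Cauchy y"
  proof (rule metric_CauchyI)
    fix e :: real assume e: "0 < e"
    then obtain N where N: "1 / real (Suc N) < e\<^sup>2 / 4"
      using nat_approx_posE[of "e\<^sup>2 / 4"] by auto
    show "\<exists>M. \<forall>m\<ge>M. \<forall>n\<ge>M. dist (y m) (y n) < e"
    proof (intro exI allI impI)
      fix m n assume mn: "N \<le> m" "N \<le> n"
      have near: "(norm (x - y k))\<^sup>2 - D < e\<^sup>2 / 4" if "N \<le> k" for k
      proof -
        have "1 / real (Suc k) \<le> 1 / real (Suc N)"
          using that by (simp add: frac_le)
        also note N
        finally have "D + 1 / real (Suc k) < D + e\<^sup>2 / 4"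
          by (rule add_strict_left_mono)
        with yD[of k] show ?thesis
          by simp
      qed
      have "(norm (y m - y n))\<^sup>2 < e\<^sup>2"
        using para[OF yS yS, of m n] near[OF mn(1)] near[OF mn(2)] by argo
      then show "dist (y m) (y n) < e"
        using e by (simp add: dist_norm power_less_imp_less_base)
    qed
  qed
  then obtain l where l: "y \<longlonglongrightarrow> l"
    using convergent_eq_Cauchy by blast
  have lS: "l \<in> S"
    using closed_sequentially[OF cl _ l] yS by blast
  have "(norm (x - l))\<^sup>2 \<le> D"
  proof (rule LIMSEQ_le)
    show "(\<lambda>n. (norm (x - y n))\<^sup>2) \<longlonglongrightarrow> (norm (x - l))\<^sup>2"
      by (intro tendsto_intros l)
    show "(\<lambda>n. D + 1 / real (Suc n)) \<longlonglongrightarrow> D"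
      using tendsto_add[OF tendsto_const LIMSEQ_Suc[OF lim_1_over_n]] by fastforce
  qed (use yD in \<open>auto intro: less_imp_le\<close>)
  then have min: "(norm (x - l))\<^sup>2 \<le> (norm (x - l - t *\<^sub>R s))\<^sup>2" if "s \<in> S" for s t
    using low[of "l + t *\<^sub>R s"] that lS sub
    by (simp add: subspace_add subspace_scale diff_diff_eq del: power2_le_iff_abs_le power_mono_iff)
  have "inner (x - l) s = 0" if s: "s \<in> S" for s
  proof (cases "s = 0")
    case False
    \<comment> \<open>The \<open>t\<close> minimizing the distance from \<open>x\<close> to the line \<open>l + t *\<^sub>R s\<close>.\<close>
    define t where "t = inner (x - l) s / inner s s"
    have "(norm (x - l - t *\<^sub>R s))\<^sup>2 = (norm (x - l))\<^sup>2 - 2 * t * inner (x - l) s + t * t * inner s s"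
      unfolding power2_norm_eq_inner
      by (simp add: inner_diff_left inner_diff_right inner_commute algebra_simps)
    also have "\<dots> = (norm (x - l))\<^sup>2 - (inner (x - l) s)\<^sup>2 / inner s s"
      using False by (simp add: t_def field_simps power2_eq_square)
    finally have "(inner (x - l) s)\<^sup>2 / inner s s \<le> 0"
      using min[OF s, of t] by linarith
    then show ?thesis
      using inner_gt_zero_iff[THEN iffD2, OF False]
      by (simp add: divide_le_0_iff del: inner_gt_zero_iff)
  qed simp
  then have "x - l \<in> S\<^sup>\<bottom>"
    by (simp add: orthogonal_comp_def orthogonal_def inner_commute)
  with lS show ?thesis
    by (rule that)
qed

text \<open>
  The component \<open>z\<close> orthogonal to the kernel of a point with \<open>\<phi> x \<noteq> 0\<close> spans the complement of the
  kernel, so a multiple of it represents \<open>\<phi>\<close>.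
\<close>

lemma riesz_representation_exists:
  fixes \<phi> :: "'v::{real_inner, complete_space} \<Rightarrow> real"
  assumes lin: "linear \<phi>" and cont: "continuous_on UNIV \<phi>"
  obtains b where "\<And>v. inner b v = \<phi> v"
proof (cases "\<exists>x. \<phi> x \<noteq> 0")
  case True
  then obtain x where x: "\<phi> x \<noteq> 0" by blast
  have "closed {v. \<phi> v = 0}"
    by (intro closed_Collect_eq cont continuous_on_const)
  moreover have "subspace {v. \<phi> v = 0}"
    by (rule linear_subspace_kernel[OF lin])
  ultimately obtain y where y: "\<phi> y = 0" and orth: "x - y \<in> {v. \<phi> v = 0}\<^sup>\<bottom>"
    using orthogonal_projection_exists[of "{v. \<phi> v = 0}" x] by auto
  define z where "z = x - y"
  have z: "\<phi> z = \<phi> x"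
    using lin y by (simp add: z_def linear_diff)
  have "z \<noteq> 0"
    using z x linear_0[OF lin] by metis
  have "inner ((\<phi> z / inner z z) *\<^sub>R z) v = \<phi> v" for v
  proof -
    have "\<phi> (v - (\<phi> v / \<phi> z) *\<^sub>R z) = 0"
      using x z lin by (simp add: linear_diff linear_scale)
    then have "inner z (v - (\<phi> v / \<phi> z) *\<^sub>R z) = 0"
      using orth unfolding z_def[symmetric] orthogonal_comp_def orthogonal_def
      by (simp add: inner_commute[of z])
    then have "inner z v = (\<phi> v / \<phi> z) * inner z z"
      by (simp add: inner_diff_right)
    then show ?thesis
      using \<open>z \<noteq> 0\<close> x z by simp
  qed
  then show ?thesis
    by (rule that)
next
  case False
  then show ?thesis
    using that[of 0] by simp
qed

section \<open>Form spaces realized isometrically in a Hilbert space\<close>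

text \<open>
  Along an injective map of this kind with complete image, all Hilbert space axioms are inherited from
  the ambient space; they are never checked on classes of Cauchy sequences.  Injectivity is not part
  of the notion, so that it also applies to \<open>B\<close> before its kernel is divided out.
\<close>

definition isometric_linear_map :: "('a, 'z) form_space_scheme \<Rightarrow> ('a \<Rightarrow> 'v::real_inner) \<Rightarrow> bool"
where
  "isometric_linear_map S b \<longleftrightarrow>
     vzero S \<in> vcarrier S \<and> b (vzero S) = 0 \<and>
     (\<forall>x\<in>vcarrier S. \<forall>y\<in>vcarrier S.
        vadd S x y \<in> vcarrier S \<and> b (vadd S x y) = b x + b y \<and> vform S x y = inner (b x) (b y)) \<and>
     (\<forall>a. \<forall>x\<in>vcarrier S. vscale S a x \<in> vcarrier S \<and> b (vscale S a x) = a *\<^sub>R b x)"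

context
  fixes S :: "('a, 'z) form_space_scheme" and b :: "'a \<Rightarrow> 'v::real_inner"
  assumes iso: "isometric_linear_map S b"
begin

lemma isometric_linear_mapD:
  shows "vzero S \<in> vcarrier S" "b (vzero S) = 0"
    and "\<lbrakk>x \<in> vcarrier S; y \<in> vcarrier S\<rbrakk> \<Longrightarrow> vadd S x y \<in> vcarrier S"
    and "\<lbrakk>x \<in> vcarrier S; y \<in> vcarrier S\<rbrakk> \<Longrightarrow> b (vadd S x y) = b x + b y"
    and "\<lbrakk>x \<in> vcarrier S; y \<in> vcarrier S\<rbrakk> \<Longrightarrow> vform S x y = inner (b x) (b y)"
    and "x \<in> vcarrier S \<Longrightarrow> vscale S a x \<in> vcarrier S"
    and "x \<in> vcarrier S \<Longrightarrow> b (vscale S a x) = a *\<^sub>R b x"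
  using iso unfolding isometric_linear_map_def by blast+

lemma isometric_linear_map_semidefinite: "positive_semidefinite_form S"
  unfolding positive_semidefinite_form_def
  by (intro conjI ballI allI) (simp_all add: isometric_linear_mapD inner_add_left, rule inner_commute)

lemma form_norm_isometric: "x \<in> vcarrier S \<Longrightarrow> form_norm S x = norm (b x)"
  by (simp add: form_norm_def isometric_linear_mapD norm_eq_sqrt_inner)

lemma form_dist_isometric:
  "\<lbrakk>x \<in> vcarrier S; y \<in> vcarrier S\<rbrakk> \<Longrightarrow> form_dist S x y = dist (b x) (b y)"
  by (simp add: form_dist_def form_norm_isometric isometric_linear_mapD dist_norm)

context
  assumes inj: "inj_on b (vcarrier S)"
begin

lemma isometric_linear_map_eqI:
  "\<lbrakk>x \<in> vcarrier S; y \<in> vcarrier S; b x = b y\<rbrakk> \<Longrightarrow> x = y"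
  using inj by (rule inj_onD)

lemma isometric_linear_map_vector_space: "vector_space_axioms S"
  unfolding vector_space_axioms_def
  by (intro conjI ballI allI)
     (auto intro!: isometric_linear_map_eqI simp: isometric_linear_mapD algebra_simps)

lemma isometric_linear_map_metric: "Metric_space (vcarrier S) (form_dist S)"
proof
  show "0 \<le> form_dist S x y" for x y
    by (cases "x \<in> vcarrier S \<and> y \<in> vcarrier S")
       (simp add: form_dist_isometric, auto simp: form_dist_def)
  show "form_dist S x y = form_dist S y x" for x y
    by (cases "x \<in> vcarrier S \<and> y \<in> vcarrier S")
       (simp add: form_dist_isometric dist_commute, auto simp: form_dist_def)
qed (auto simp: form_dist_isometric dist_triangle intro: isometric_linear_map_eqI)

text \<open>
  Since \<open>b\<close> preserves distances, \<open>S\<close> is complete as soon as its image is; the next two lemmas carry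
  this from the carrier-set notion of a Cauchy sequence to the usual one.
\<close>

lemma cauchy_sequences_isometric:
  "s \<in> cauchy_sequences S \<longleftrightarrow> (\<forall>n. s n \<in> vcarrier S) \<and> Cauchy (\<lambda>n. b (s n))"
proof (cases "\<forall>n. s n \<in> vcarrier S")
  case True
  then show ?thesis
    by (auto simp: cauchy_sequences_def Metric_space.MCauchy_def[OF isometric_linear_map_metric]
        form_dist_isometric Cauchy_def)
qed (auto simp: cauchy_sequences_def Metric_space.MCauchy_def[OF isometric_linear_map_metric])

lemma isometric_linear_map_hilbert:
  assumes "complete (b ` vcarrier S)"
  shows "is_hilbert_space S"
proof -
  interpret Metric_space "vcarrier S" "form_dist S"
    by (rule isometric_linear_map_metric)
  have "mcomplete"
    unfolding mcomplete_def
  proof (intro allI impI)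
    fix s assume "MCauchy s"
    then have s: "s n \<in> vcarrier S" and "Cauchy (\<lambda>n. b (s n))" for n
      using cauchy_sequences_isometric[of s] by (auto simp: cauchy_sequences_def)
    then obtain l where l: "l \<in> b ` vcarrier S" "(\<lambda>n. b (s n)) \<longlonglongrightarrow> l"
      using assms unfolding complete_def by (metis imageI)
    then obtain x where x: "x \<in> vcarrier S" "l = b x"
      by blast
    have "limitin mtopology s x sequentially"
      unfolding limitin_metric_dist_null using x l s tendsto_dist_iff[of "\<lambda>n. b (s n)" l]
      by (simp add: form_dist_isometric)
    then show "\<exists>x. limitin mtopology s x sequentially" ..
  qed
  then show ?thesis
    unfolding is_hilbert_space_def
    using isometric_linear_map_vector_space isometric_linear_map_semidefinite
    by (auto intro!: isometric_linear_map_eqI simp: isometric_linear_mapD)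
qed

end
end

section \<open>Quotients and completions of realized spaces\<close>

lemma with_form_simps [simp]:
  "vcarrier (with_form S q) = vcarrier S" "vzero (with_form S q) = vzero S"
  "vadd (with_form S q) = vadd S" "vscale (with_form S q) = vscale S"
  "vform (with_form S q) = q"
  by (simp_all add: with_form_def vspace.defs form_space.defs)

lemma linear_subspaceD:
  assumes "linear_subspace S N"
  shows "x \<in> N \<Longrightarrow> x \<in> vcarrier S" and "vzero S \<in> N"
    and "\<lbrakk>x \<in> N; y \<in> N\<rbrakk> \<Longrightarrow> vadd S x y \<in> N" and "x \<in> N \<Longrightarrow> vscale S a x \<in> N"
  using assms unfolding linear_subspace_def by blast+

context
  fixes S :: "('a, 'z) vspace_scheme"
  assumes vs: "vector_space_axioms S"
begin

lemma vector_spaceD: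
  shows "vzero S \<in> vcarrier S"
    and "\<lbrakk>x \<in> vcarrier S; y \<in> vcarrier S\<rbrakk> \<Longrightarrow> vadd S x y \<in> vcarrier S"
    and "x \<in> vcarrier S \<Longrightarrow> vscale S a x \<in> vcarrier S"
    and "\<lbrakk>x \<in> vcarrier S; y \<in> vcarrier S; z \<in> vcarrier S\<rbrakk>
      \<Longrightarrow> vadd S (vadd S x y) z = vadd S x (vadd S y z)"
    and "\<lbrakk>x \<in> vcarrier S; y \<in> vcarrier S\<rbrakk> \<Longrightarrow> vadd S x y = vadd S y x"
    and "x \<in> vcarrier S \<Longrightarrow> vadd S (vzero S) x = x"
    and "x \<in> vcarrier S \<Longrightarrow> vadd S x (vscale S (- 1) x) = vzero S"
    and "\<lbrakk>x \<in> vcarrier S; y \<in> vcarrier S\<rbrakk>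
      \<Longrightarrow> vscale S a (vadd S x y) = vadd S (vscale S a x) (vscale S a y)"
    and "x \<in> vcarrier S \<Longrightarrow> vscale S (a + c) x = vadd S (vscale S a x) (vscale S c x)"
    and "x \<in> vcarrier S \<Longrightarrow> vscale S a (vscale S c x) = vscale S (a * c) x"
    and "x \<in> vcarrier S \<Longrightarrow> vscale S 1 x = x"
  using vs unfolding vector_space_axioms_def by blast+

lemma vadd_zero_right: "x \<in> vcarrier S \<Longrightarrow> vadd S x (vzero S) = x"
  using vector_spaceD(1,5,6) by metis

lemma vadd_swap:
  assumes "x \<in> vcarrier S" "y \<in> vcarrier S" "k \<in> vcarrier S" "l \<in> vcarrier S"
  shows "vadd S (vadd S x k) (vadd S y l) = vadd S (vadd S x y) (vadd S k l)"
proof -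
  have "vadd S k (vadd S y l) = vadd S y (vadd S k l)"
    using assms vector_spaceD(4)[of k y l] vector_spaceD(4)[of y k l] vector_spaceD(5)[of k y]
    by simp
  then show ?thesis
    using assms by (simp add: vector_spaceD(2,4))
qed

context
  fixes N :: "'a set"
  assumes sub: "linear_subspace S N"
begin

lemmas subspaceD = linear_subspaceD[OF sub]

lemma coset_zero: "coset S N (vzero S) = N"
  unfolding coset_def using vector_spaceD(6) subspaceD(1) by force

lemma self_in_coset: "x \<in> vcarrier S \<Longrightarrow> x \<in> coset S N x"
  unfolding coset_def using vadd_zero_right subspaceD(2) by force

lemma coset_subset_carrier: "x \<in> vcarrier S \<Longrightarrow> coset S N x \<subseteq> vcarrier S"
  unfolding coset_def using vector_spaceD(2) subspaceD(1) by blast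

lemma quotient_add:
  assumes xy: "x \<in> vcarrier S" "y \<in> vcarrier S"
  shows "{vadd S p q | p q. p \<in> coset S N x \<and> q \<in> coset S N y} = coset S N (vadd S x y)"
    (is "?L = ?R")
proof
  show "?L \<subseteq> ?R"
  proof
    fix z assume "z \<in> ?L"
    then obtain k l where "k \<in> N" "l \<in> N" "z = vadd S (vadd S x k) (vadd S y l)"
      unfolding coset_def by blast
    then show "z \<in> ?R"
      unfolding coset_def using vadd_swap[OF xy] subspaceD by blast
  qed
  show "?R \<subseteq> ?L"
  proof
    fix z assume "z \<in> ?R"
    then obtain k where k: "k \<in> N" "z = vadd S x (vadd S y k)"
      unfolding coset_def using vector_spaceD(4) xy subspaceD(1) by blast
    then show "z \<in> ?L"
      using self_in_coset[OF xy(1)] unfolding coset_def by blast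
  qed
qed

lemma quotient_scale:
  assumes x: "x \<in> vcarrier S"
  shows "{vadd S (vscale S a p) k | p k. p \<in> coset S N x \<and> k \<in> N} = coset S N (vscale S a x)"
    (is "?L = ?R")
proof
  show "?L \<subseteq> ?R"
  proof
    fix z assume "z \<in> ?L"
    then obtain k l where kl: "k \<in> N" "l \<in> N" "z = vadd S (vscale S a (vadd S x k)) l"
      unfolding coset_def by blast
    then have "z = vadd S (vscale S a x) (vadd S (vscale S a k) l)"
      using x by (simp add: vector_spaceD(2-4,8) subspaceD(1))
    then show "z \<in> ?R"
      unfolding coset_def using kl subspaceD by blast
  qed
  show "?R \<subseteq> ?L"
    using self_in_coset[OF x] unfolding coset_def by blast
qed

lemma quotient_vspace_ops:
  shows "vzero (quotient_vspace S N) = coset S N (vzero S)"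
    and "vcarrier (quotient_vspace S N) = coset S N ` vcarrier S"
    and "\<lbrakk>x \<in> vcarrier S; y \<in> vcarrier S\<rbrakk>
      \<Longrightarrow> vadd (quotient_vspace S N) (coset S N x) (coset S N y) = coset S N (vadd S x y)"
    and "x \<in> vcarrier S
      \<Longrightarrow> vscale (quotient_vspace S N) a (coset S N x) = coset S N (vscale S a x)"
  using quotient_add quotient_scale coset_zero by (simp_all add: quotient_vspace_def)

lemma quotient_vector_space: "vector_space_axioms (quotient_vspace S N)"
  unfolding vector_space_axioms_def quotient_vspace_ops(1,2) ball_simps
  by (intro conjI ballI allI)
     (simp_all add: quotient_vspace_ops(3,4) vector_spaceD(1-4,6-11), simp_all add: vector_spaceD(5))

end
end

lemma vector_space_on_subspace:
  fixes S :: "('a, 'z) vspace_scheme"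
  assumes "vector_space_axioms S" "linear_subspace S N"
  shows "vector_space_axioms (S\<lparr>vcarrier := N\<rparr>)"
proof -
  have "vcarrier (S\<lparr>vcarrier := N\<rparr>) = N" "vzero (S\<lparr>vcarrier := N\<rparr>) = vzero S"
    "vadd (S\<lparr>vcarrier := N\<rparr>) = vadd S" "vscale (S\<lparr>vcarrier := N\<rparr>) = vscale S"
    by simp_all
  note eqs = this and V = vector_spaceD[OF assms(1)] and sub = linear_subspaceD[OF assms(2)]
  show ?thesis
    unfolding vector_space_axioms_def eqs
  proof (intro conjI ballI allI)
    show "vadd S x y = vadd S y x" if "x \<in> N" "y \<in> N" for x y
      using that by (intro V(5) sub(1))
  qed (simp_all add: sub V(4,6-11))
qed

lemma vector_space_with_form: "vector_space_axioms (with_form S q) \<longleftrightarrow> vector_space_axioms S"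
  by (simp add: vector_space_axioms_def)

text \<open>
  The choice of representative is harmless on cosets of a subspace of the kernel of \<open>b\<close>.
\<close>

definition map_on_quotient :: "('a \<Rightarrow> 'v) \<Rightarrow> 'a set \<Rightarrow> 'v" where
  "map_on_quotient b P = b (SOME x. x \<in> P)"

context
  fixes S :: "('a, 'z) form_space_scheme" and b :: "'a \<Rightarrow> 'v::real_inner" and N :: "'a set"
  assumes vs: "vector_space_axioms S" and iso: "isometric_linear_map S b"
    and N: "N = {x \<in> vcarrier S. b x = 0}"
begin

lemma kernel_linear_subspace: "linear_subspace S N"
  unfolding linear_subspace_def N by (auto simp: isometric_linear_mapD[OF iso])

lemma map_on_quotient_coset:
  assumes "x \<in> vcarrier S"
  shows "map_on_quotient b (coset S N x) = b x"
proof -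
  have "(SOME y. y \<in> coset S N x) \<in> coset S N x"
    using self_in_coset[OF vs kernel_linear_subspace assms] by (rule someI)
  then show ?thesis
    using assms unfolding map_on_quotient_def coset_def N
    by (auto simp: isometric_linear_mapD[OF iso])
qed

text \<open>
  The quotient form is defined by arbitrary representatives, and any two choices have the same image
  under \<open>b\<close>.
\<close>

lemma quotient_isometric_linear_map:
  "isometric_linear_map (quotient_form_space S N) (map_on_quotient b)"
proof -
  have some: "(SOME y. y \<in> coset S N x) \<in> vcarrier S" if "x \<in> vcarrier S" for x
    using self_in_coset[OF vs kernel_linear_subspace that]
      coset_subset_carrier[OF vs kernel_linear_subspace that] by (metis someI subsetD)
  note ops = quotient_vspace_ops[OF vs kernel_linear_subspace]
    and b_some = map_on_quotient_coset[unfolded map_on_quotient_def]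
  show ?thesis
    unfolding isometric_linear_map_def quotient_form_space_def with_form_simps ops(1,2) ball_simps
    by (intro conjI ballI allI)
       (simp_all add: ops(3,4) map_on_quotient_coset isometric_linear_mapD[OF iso] some b_some)
qed

lemma quotient_carrier: "vcarrier (quotient_form_space S N) = coset S N ` vcarrier S"
  by (simp add: quotient_form_space_def quotient_vspace_def)

lemma map_on_quotient_image: "map_on_quotient b ` vcarrier (quotient_form_space S N) = b ` vcarrier S"
  unfolding quotient_carrier image_image by (rule image_cong[OF refl map_on_quotient_coset])

lemma map_on_quotient_inj: "inj_on (map_on_quotient b) (vcarrier (quotient_form_space S N))"
proof (rule inj_onI)
  have coset_mono: "coset S N x \<subseteq> coset S N y"
    if xy: "x \<in> vcarrier S" "y \<in> vcarrier S" "b x = b y" for x y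
  proof -
    note V = vector_spaceD[OF vs] and sub = linear_subspaceD[OF kernel_linear_subspace]
    define d where "d = vadd S x (vscale S (-1) y)"
    have d: "d \<in> N"
      unfolding d_def N using xy by (simp add: isometric_linear_mapD[OF iso])
    have "vadd S y d = vadd S d y"
      using xy by (intro V(5)) (simp_all add: d_def V(2,3))
    also have "\<dots> = vadd S x (vadd S (vscale S (-1) y) y)"
      using xy by (simp add: d_def V(3,4))
    also have "vadd S (vscale S (-1) y) y = vzero S"
      using xy V(5)[of "vscale S (-1) y" y] by (simp add: V(3,7))
    also have "vadd S x (vzero S) = x"
      using xy(1) by (rule vadd_zero_right[OF vs])
    finally have "vadd S y d = x" .
    then have "vadd S x k = vadd S y (vadd S d k)" if "k \<in> N" for k
      using V(4)[of y d k] that d xy sub(1) by auto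
    then show ?thesis
      unfolding coset_def using d sub(3) by blast
  qed
  fix P Q assume "P \<in> vcarrier (quotient_form_space S N)" "Q \<in> vcarrier (quotient_form_space S N)"
    "map_on_quotient b P = map_on_quotient b Q"
  then obtain x y where xy: "x \<in> vcarrier S" "y \<in> vcarrier S" "b x = b y"
    and PQ: "P = coset S N x" "Q = coset S N y"
    unfolding quotient_carrier by (auto simp: map_on_quotient_coset)
  show "P = Q"
    unfolding PQ using coset_mono[OF xy] coset_mono[OF xy(2,1) xy(3)[symmetric]] by (rule equalityI)
qed

end

text \<open>
  The extension of \<open>b\<close> by continuity: a class of Cauchy sequences goes to the common limit of the
  images.
\<close>

definition map_on_completion :: "('a \<Rightarrow> 'v::real_inner) \<Rightarrow> (nat \<Rightarrow> 'a) set \<Rightarrow> 'v" where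
  "map_on_completion b P = lim (\<lambda>n. b ((SOME s. s \<in> P) n))"

context
  fixes S :: "('a, 'z) form_space_scheme" and b :: "'a \<Rightarrow> 'v::{real_inner, complete_space}"
  assumes iso: "isometric_linear_map S b" and inj: "inj_on b (vcarrier S)"
begin

lemma cauchy_sequences_iff_convergent:
  "s \<in> cauchy_sequences S \<longleftrightarrow> (\<forall>n. s n \<in> vcarrier S) \<and> (\<exists>l. (\<lambda>n. b (s n)) \<longlonglongrightarrow> l)"
  by (simp add: cauchy_sequences_isometric[OF iso inj] convergent_eq_Cauchy)

text \<open>
  A class is determined by the limit of the images of its members.  This makes the extension of \<open>b\<close>
  to the completion well defined and injective.
\<close>

lemma cauchy_class_limit:
  assumes s: "\<And>n. s n \<in> vcarrier S" "(\<lambda>n. b (s n)) \<longlonglongrightarrow> l"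
  shows "cauchy_class S s = {t. (\<forall>n. t n \<in> vcarrier S) \<and> (\<lambda>n. b (t n)) \<longlonglongrightarrow> l}"
proof -
  have "(\<lambda>n. form_dist S (s n) (t n)) \<longlonglongrightarrow> 0 \<longleftrightarrow> (\<lambda>n. b (t n)) \<longlonglongrightarrow> l"
    if t: "\<And>n. t n \<in> vcarrier S" for t
  proof
    assume "(\<lambda>n. form_dist S (s n) (t n)) \<longlonglongrightarrow> 0"
    then have "(\<lambda>n. dist (b (t n)) (b (s n))) \<longlonglongrightarrow> 0"
      using s t by (simp add: form_dist_isometric[OF iso] dist_commute)
    then have "(\<lambda>n. b (t n) - b (s n)) \<longlonglongrightarrow> 0"
      by (simp add: dist_norm tendsto_norm_zero_iff)
    with s(2) show "(\<lambda>n. b (t n)) \<longlonglongrightarrow> l"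
      by (rule Lim_transform)
  next
    assume "(\<lambda>n. b (t n)) \<longlonglongrightarrow> l"
    then have "(\<lambda>n. dist (b (s n)) (b (t n))) \<longlonglongrightarrow> dist l l"
      by (intro tendsto_dist s(2))
    then show "(\<lambda>n. form_dist S (s n) (t n)) \<longlonglongrightarrow> 0"
      using s t by (simp add: form_dist_isometric[OF iso])
  qed
  then show ?thesis
    unfolding cauchy_class_def cauchy_sequences_iff_convergent by blast
qed

lemma map_on_completion_class:
  assumes s: "\<And>n. s n \<in> vcarrier S" "(\<lambda>n. b (s n)) \<longlonglongrightarrow> l"
  shows "map_on_completion b (cauchy_class S s) = l"
proof -
  have "s \<in> cauchy_class S s"
    using s by (simp add: cauchy_class_limit[OF s])
  then have "(SOME t. t \<in> cauchy_class S s) \<in> cauchy_class S s"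
    using some_in_eq by blast
  then show ?thesis
    unfolding map_on_completion_def by (simp add: cauchy_class_limit[OF s] limI)
qed

lemma completion_representative:
  assumes "P \<in> vcarrier (completion S)"
  shows "(SOME s. s \<in> P) n \<in> vcarrier S"
    and "(\<lambda>n. b ((SOME s. s \<in> P) n)) \<longlonglongrightarrow> map_on_completion b P"
    and "P = {t. (\<forall>n. t n \<in> vcarrier S) \<and> (\<lambda>n. b (t n)) \<longlonglongrightarrow> map_on_completion b P}"
proof -
  obtain s where "s \<in> cauchy_sequences S" and P: "P = cauchy_class S s"
    using assms unfolding completion_def by auto
  then obtain l where s: "\<And>n. s n \<in> vcarrier S" "(\<lambda>n. b (s n)) \<longlonglongrightarrow> l"
    unfolding cauchy_sequences_iff_convergent by blast
  have l: "map_on_completion b P = l"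
    unfolding P by (rule map_on_completion_class[OF s])
  have eq: "P = {t. (\<forall>n. t n \<in> vcarrier S) \<and> (\<lambda>n. b (t n)) \<longlonglongrightarrow> l}"
    unfolding P by (rule cauchy_class_limit[OF s])
  then show "P = {t. (\<forall>n. t n \<in> vcarrier S) \<and> (\<lambda>n. b (t n)) \<longlonglongrightarrow> map_on_completion b P}"
    unfolding l .
  have "s \<in> P"
    using s unfolding eq by simp
  then have "(SOME s. s \<in> P) \<in> P"
    using some_in_eq by blast
  then have "(SOME s. s \<in> P) \<in> {t. (\<forall>n. t n \<in> vcarrier S) \<and> (\<lambda>n. b (t n)) \<longlonglongrightarrow> l}"
    by (simp only: eq[symmetric])
  then show "(SOME s. s \<in> P) n \<in> vcarrier S"
    and "(\<lambda>n. b ((SOME s. s \<in> P) n)) \<longlonglongrightarrow> map_on_completion b P"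
    unfolding l by simp_all
qed

lemma cauchy_class_in_completion:
  assumes "\<And>n. s n \<in> vcarrier S" "(\<lambda>n. b (s n)) \<longlonglongrightarrow> l"
  shows "cauchy_class S s \<in> vcarrier (completion S)"
  using assms unfolding completion_def by (auto simp: cauchy_sequences_iff_convergent intro!: imageI)

lemma map_on_completion_inj: "inj_on (map_on_completion b) (vcarrier (completion S))"
proof (rule inj_onI)
  let ?F = "\<lambda>l. {t. (\<forall>n. t n \<in> vcarrier S) \<and> (\<lambda>n. b (t n)) \<longlonglongrightarrow> l}"
  fix P Q assume PQ: "P \<in> vcarrier (completion S)" "Q \<in> vcarrier (completion S)"
    and eq: "map_on_completion b P = map_on_completion b Q"
  have "P = ?F (map_on_completion b P)"
    by (rule completion_representative(3)[OF PQ(1)])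
  also have "\<dots> = ?F (map_on_completion b Q)"
    by (simp only: eq)
  also have "\<dots> = Q"
    by (rule completion_representative(3)[OF PQ(2), symmetric])
  finally show "P = Q" .
qed

lemma completion_isometric_linear_map: "isometric_linear_map (completion S) (map_on_completion b)"
proof -
  note D = isometric_linear_mapD[OF iso] and R = completion_representative
  have ops: "vzero (completion S) = cauchy_class S (\<lambda>_. vzero S)"
    "vadd (completion S) P Q =
      cauchy_class S (\<lambda>n. vadd S ((SOME s. s \<in> P) n) ((SOME t. t \<in> Q) n))"
    "vscale (completion S) a P = cauchy_class S (\<lambda>n. vscale S a ((SOME s. s \<in> P) n))"
    "vform (completion S) P Q = lim (\<lambda>n. vform S ((SOME s. s \<in> P) n) ((SOME t. t \<in> Q) n))"
    for P Q a
    by (simp_all only: completion_def form_space.simps vspace.simps)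
  have zero: "vzero (completion S) \<in> vcarrier (completion S) \<and>
      map_on_completion b (vzero (completion S)) = 0"
    using cauchy_class_in_completion[of "\<lambda>_. vzero S" 0] map_on_completion_class[of "\<lambda>_. vzero S" 0]
    unfolding ops by (simp add: D(1,2))
  have add: "vadd (completion S) P Q \<in> vcarrier (completion S) \<and>
      map_on_completion b (vadd (completion S) P Q) = map_on_completion b P + map_on_completion b Q"
    if PQ: "P \<in> vcarrier (completion S)" "Q \<in> vcarrier (completion S)" for P Q
  proof -
    let ?s = "\<lambda>n. vadd S ((SOME s. s \<in> P) n) ((SOME t. t \<in> Q) n)"
    have s: "\<And>n. ?s n \<in> vcarrier S"
      using R(1)[OF PQ(1)] R(1)[OF PQ(2)] by (simp add: D)
    have "(\<lambda>n. b (?s n)) \<longlonglongrightarrow> map_on_completion b P + map_on_completion b Q"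
      using R(1)[OF PQ(1)] R(1)[OF PQ(2)] tendsto_add[OF R(2)[OF PQ(1)] R(2)[OF PQ(2)]]
      by (simp add: D)
    note s this
    from cauchy_class_in_completion[OF this] map_on_completion_class[OF this] show ?thesis
      unfolding ops by blast
  qed
  have scale: "vscale (completion S) a P \<in> vcarrier (completion S) \<and>
      map_on_completion b (vscale (completion S) a P) = a *\<^sub>R map_on_completion b P"
    if P: "P \<in> vcarrier (completion S)" for a P
  proof -
    let ?s = "\<lambda>n. vscale S a ((SOME s. s \<in> P) n)"
    have s: "\<And>n. ?s n \<in> vcarrier S"
      using R(1)[OF P] by (simp add: D)
    have "(\<lambda>n. b (?s n)) \<longlonglongrightarrow> a *\<^sub>R map_on_completion b P"
      using R(1)[OF P] tendsto_scaleR[OF tendsto_const R(2)[OF P]] by (simp add: D)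
    note s this
    from cauchy_class_in_completion[OF this] map_on_completion_class[OF this] show ?thesis
      unfolding ops by blast
  qed
  have form: "vform (completion S) P Q = inner (map_on_completion b P) (map_on_completion b Q)"
    if PQ: "P \<in> vcarrier (completion S)" "Q \<in> vcarrier (completion S)" for P Q
    using limI[OF tendsto_inner[OF R(2)[OF PQ(1)] R(2)[OF PQ(2)]]] R(1)[OF PQ(1)] R(1)[OF PQ(2)]
    unfolding ops by (simp add: D(5))
  show ?thesis
    unfolding isometric_linear_map_def using zero add scale form by blast
qed

text \<open>
  The abstract completion is thus the closure of \<open>b ` vcarrier S\<close>; its completeness is the closedness
  of that closure.
\<close>

lemma map_on_completion_image: "map_on_completion b ` vcarrier (completion S) = closure (b ` vcarrier S)"
proof
  show "map_on_completion b ` vcarrier (completion S) \<subseteq> closure (b ` vcarrier S)"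
  proof
    fix l assume "l \<in> map_on_completion b ` vcarrier (completion S)"
    then obtain P where P: "P \<in> vcarrier (completion S)" "l = map_on_completion b P"
      by blast
    show "l \<in> closure (b ` vcarrier S)"
      unfolding closure_sequential P(2)
      using completion_representative(1,2)[OF P(1)]
      by (intro exI[of _ "\<lambda>n. b ((SOME s. s \<in> P) n)"]) blast
  qed
  show "closure (b ` vcarrier S) \<subseteq> map_on_completion b ` vcarrier (completion S)"
  proof
    fix l assume "l \<in> closure (b ` vcarrier S)"
    then obtain u where "\<forall>n. u n \<in> b ` vcarrier S" "u \<longlonglongrightarrow> l"
      unfolding closure_sequential by blast
    moreover from this obtain s where "\<And>n. s n \<in> vcarrier S" "\<And>n. u n = b (s n)"
      unfolding image_iff by metis
    moreover from this have "u = (\<lambda>n. b (s n))"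
      by blast
    ultimately have "\<And>n. s n \<in> vcarrier S" "(\<lambda>n. b (s n)) \<longlonglongrightarrow> l"
      by simp_all
    from cauchy_class_in_completion[OF this] map_on_completion_class[OF this]
    show "l \<in> map_on_completion b ` vcarrier (completion S)"
      by blast
  qed
qed

lemma completion_hilbert: "is_hilbert_space (completion S)"
  using completion_isometric_linear_map map_on_completion_inj
  by (rule isometric_linear_map_hilbert) (simp add: map_on_completion_image complete_eq_closed)

lemma completion_embed_isometric:
  assumes "x \<in> vcarrier S"
  shows "completion_embed S x \<in> vcarrier (completion S)"
    and "map_on_completion b (completion_embed S x) = b x"
  unfolding completion_embed_def
  by (rule cauchy_class_in_completion[of "\<lambda>_. x" "b x"], simp_all add: assms)
     (rule map_on_completion_class[of "\<lambda>_. x" "b x"], simp_all add: assms)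

end

section \<open>Injectivity and isometry on the horizontal space\<close>

lemma closed_orthogonal_comp: "closed (W\<^sup>\<bottom> :: 'v::real_inner set)"
proof -
  have "W\<^sup>\<bottom> = (\<Inter>y\<in>W. {x. inner y x = 0})"
    by (auto simp: orthogonal_comp_def orthogonal_def)
  then show ?thesis
    by (auto intro!: closed_INT closed_Collect_eq continuous_intros)
qed

lemma closure_of_subspace:
  fixes S :: "'v::real_inner set"
  assumes S: "subspace S"
  shows "subspace (closure S)"
proof (rule subspaceI)
  show "0 \<in> closure S"
    using closure_subset subspace_0[OF S] by blast
next
  fix x y assume "x \<in> closure S" "y \<in> closure S"
  then obtain u v where "\<forall>n. u n \<in> S" "u \<longlonglongrightarrow> x" "\<forall>n. v n \<in> S" "v \<longlonglongrightarrow> y"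
    unfolding closure_sequential by blast
  then show "x + y \<in> closure S"
    unfolding closure_sequential using tendsto_add[of u x _ v y] subspace_add[OF S]
    by (intro exI[of _ "\<lambda>n. u n + v n"]) simp
next
  fix c x assume "x \<in> closure S"
  then obtain u where "\<forall>n. u n \<in> S" "u \<longlonglongrightarrow> x"
    unfolding closure_sequential by blast
  then show "c *\<^sub>R x \<in> closure S"
    unfolding closure_sequential using tendsto_scaleR[OF tendsto_const, of u x _ c] subspace_scale[OF S]
    by (intro exI[of _ "\<lambda>n. c *\<^sub>R u n"]) simp
qed

context
  fixes A :: "'v::real_inner \<Rightarrow> 'm dist"
  assumes lin: "\<And>v w a b. A (a *\<^sub>R v + b *\<^sub>R w) = (\<lambda>\<phi>. a * A v \<phi> + b * A w \<phi>)"
begin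

lemma pointwise_linear_simps:
  "A (v + w) = (\<lambda>\<phi>. A v \<phi> + A w \<phi>)" "A (c *\<^sub>R v) = (\<lambda>\<phi>. c * A v \<phi>)"
  "A (v - w) = (\<lambda>\<phi>. A v \<phi> - A w \<phi>)" "A 0 = (\<lambda>_. 0)"
  using lin[of 1 v 1 w] lin[of c v 0 v] lin[of 1 v "-1" w] lin[of 0 v 0 v] by simp_all

lemma subspace_kernel_space: "subspace (kernel_space A)"
  by (rule subspaceI) (auto simp: kernel_space_def pointwise_linear_simps fun_eq_iff)

lemma closed_kernel_space:
  assumes "continuous_on UNIV A"
  shows "closed (kernel_space A)"
proof -
  have "kernel_space A = (\<Inter>\<phi>. {v. A v \<phi> = 0})"
    by (auto simp: kernel_space_def fun_eq_iff)
  then show ?thesis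
    using continuous_on_product_then_coordinatewise[OF assms]
    by (auto intro!: closed_INT closed_Collect_eq continuous_intros)
qed

lemma subspace_horizontal_space: "subspace (horizontal_space A)"
  unfolding horizontal_space_def by (rule subspace_orthogonal_comp)

text \<open>
  Two preimages of the same distribution differ by an element of the kernel, to which the horizontal
  one is orthogonal.  Hence the horizontal preimage is unique and has the least norm, which is the
  content of the next two results.
\<close>

lemma horizontal_orthogonal:
  assumes w: "w \<in> horizontal_space A" and "A v = A w"
  shows "inner v w = inner w w"
proof -
  have "v - w \<in> kernel_space A"
    using assms(2) by (simp add: kernel_space_def pointwise_linear_simps)
  then have "inner (v - w) w = 0"
    using w by (simp add: horizontal_space_def orthogonal_comp_def orthogonal_def)
  then show ?thesis
    by (simp add: inner_diff_left)
qed

lemma inj_on_horizontal_space: "inj_on A (horizontal_space A)"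
proof (rule inj_onI)
  fix v w assume vw: "v \<in> horizontal_space A" "w \<in> horizontal_space A" "A v = A w"
  then have "inner v w = inner w w" "inner w v = inner v v"
    by (auto intro: horizontal_orthogonal)
  then show "v = w"
    by (metis inner_commute vector_eq)
qed

lemma tangent_norm_horizontal:
  assumes w: "w \<in> horizontal_space A"
  shows "tangent_norm A (A w) = norm w"
  unfolding tangent_norm_def
proof (rule cInf_eq_minimum)
  fix r assume "r \<in> {norm v |v. A v = A w}"
  then obtain v where v: "r = norm v" "A v = A w"
    by blast
  have "norm w * norm w \<le> norm v * norm w"
    using horizontal_orthogonal[OF w v(2)] norm_cauchy_schwarz[of v w]
    by (simp add: power2_norm_eq_inner flip: power2_eq_square)
  then show "norm w \<le> r"
    using v(1) by (cases "w = 0") auto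
qed auto

lemma range_eq_image_horizontal:
  assumes "\<And>v. \<exists>y\<in>kernel_space A. v - y \<in> horizontal_space A"
  shows "range A = A ` horizontal_space A"
proof
  show "range A \<subseteq> A ` horizontal_space A"
  proof (rule image_subsetI)
    fix v
    obtain y where "y \<in> kernel_space A" "v - y \<in> horizontal_space A"
      using assms by blast
    moreover from this have "A v = A (v - y)"
      by (simp add: pointwise_linear_simps kernel_space_def)
    ultimately show "A v \<in> A ` horizontal_space A"
      by blast
  qed
qed auto

context
  fixes T :: "('a, 'z) form_space_scheme" and \<Lambda> :: "'a \<Rightarrow> 'v"
  assumes iso: "isometric_linear_map T \<Lambda>"
    and horizontal: "\<Lambda> ` vcarrier T \<subseteq> horizontal_space A"
begin

text \<open>
  On horizontal vectors \<open>A\<close> is injective and carries the norm to the quotient norm, so composing it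
  with an isometric bijection onto horizontal vectors gives an isometric isomorphism.
\<close>

lemma horizontal_isometric_isomorphism:
  assumes inj: "inj_on \<Lambda> (vcarrier T)"
  shows "isometric_isomorphism T (A ` \<Lambda> ` vcarrier T) (tangent_norm A) (\<lambda>x. A (\<Lambda> x))"
proof -
  have "inj_on (A \<circ> \<Lambda>) (vcarrier T)"
    using inj inj_on_subset[OF inj_on_horizontal_space horizontal] by (rule comp_inj_on)
  then have "bij_betw (\<lambda>x. A (\<Lambda> x)) (vcarrier T) (A ` \<Lambda> ` vcarrier T)"
    by (auto simp: bij_betw_def comp_def image_image)
  moreover have "tangent_norm A (A (\<Lambda> x)) = form_norm T x" if "x \<in> vcarrier T" for x
    using that horizontal by (subst tangent_norm_horizontal) (auto simp: form_norm_isometric[OF iso])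
  ultimately show ?thesis
    unfolding isometric_isomorphism_def
    by (simp add: isometric_linear_mapD[OF iso] pointwise_linear_simps)
qed

text \<open>
  If \<open>L x = A w\<close> with \<open>w\<close> horizontal, then linearity and isometry of \<open>L\<close> turn agreement on \<open>D\<close> into
  \<open>dist w (\<Lambda> d) = dist (\<Lambda> x) (\<Lambda> d)\<close> for all \<open>d\<close> in \<open>D\<close>, and
  \<open>\<Lambda> d\<close> may be taken arbitrarily close to \<open>\<Lambda> x\<close>.
\<close>

lemma isometric_isomorphism_unique:
  assumes L: "isometric_isomorphism T (A ` \<Lambda> ` vcarrier T) (tangent_norm A) L"
    and D: "D \<subseteq> vcarrier T" "\<Lambda> ` vcarrier T \<subseteq> closure (\<Lambda> ` D)" "\<And>d. d \<in> D \<Longrightarrow> L d = A (\<Lambda> d)"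
    and x: "x \<in> vcarrier T"
  shows "L x = A (\<Lambda> x)"
proof -
  note I = isometric_linear_mapD[OF iso]
  have "L x \<in> A ` \<Lambda> ` vcarrier T"
    using L x by (auto simp: isometric_isomorphism_def bij_betw_def)
  then obtain w where w: "w \<in> horizontal_space A" "L x = A w"
    using horizontal by auto
  have close: "dist w (\<Lambda> d) = dist (\<Lambda> x) (\<Lambda> d)" if d: "d \<in> D" for d
  proof -
    have dT: "d \<in> vcarrier T"
      using d D(1) by blast
    let ?z = "vadd T x (vscale T (- 1) d)"
    have "L ?z = A (w - \<Lambda> d)"
      using L x dT w(2) D(3)[OF d] by (simp add: isometric_isomorphism_def I pointwise_linear_simps)
    moreover have "tangent_norm A (L ?z) = norm (\<Lambda> x - \<Lambda> d)"
    proof -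
      have z: "?z \<in> vcarrier T" "\<Lambda> ?z = \<Lambda> x - \<Lambda> d"
        using x dT by (simp_all add: I)
      have "tangent_norm A (L ?z) = form_norm T ?z"
        using L z(1) unfolding isometric_isomorphism_def by blast
      then show ?thesis
        by (simp only: form_norm_isometric[OF iso z(1)] z(2))
    qed
    moreover have "w - \<Lambda> d \<in> horizontal_space A"
      using w(1) dT horizontal by (auto intro!: subspace_diff subspace_horizontal_space)
    ultimately show ?thesis
      by (simp add: tangent_norm_horizontal dist_norm)
  qed
  have "w = \<Lambda> x"
  proof (rule ccontr)
    assume "w \<noteq> \<Lambda> x"
    then have "0 < dist w (\<Lambda> x) / 2"
      by simp
    then obtain d where d: "d \<in> D" "dist (\<Lambda> d) (\<Lambda> x) < dist w (\<Lambda> x) / 2"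
      using D(2) x unfolding closure_approachable image_subset_iff by blast
    then show False
      using close[OF d(1)] dist_triangle[of w "\<Lambda> x" "\<Lambda> d"] by (simp add: dist_commute)
  qed
  with w(2) show ?thesis
    by simp
qed

end
end

text \<open>
  The part of a horizontal vector orthogonal to \<open>closure Z\<close> is again horizontal, because the
  horizontal space is closed and contains \<open>Z\<close>; the separation hypothesis kills it.
\<close>

lemma horizontal_subset_closure:
  fixes A :: "'v::{real_inner, complete_space} \<Rightarrow> 'm dist"
  assumes Z: "subspace Z" "Z \<subseteq> horizontal_space A"
    and sep: "\<And>w. \<lbrakk>w \<in> horizontal_space A; \<And>z. z \<in> Z \<Longrightarrow> inner z w = 0\<rbrakk> \<Longrightarrow> w = 0"
  shows "horizontal_space A \<subseteq> closure Z"
proof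
  fix w assume w: "w \<in> horizontal_space A"
  obtain y where y: "y \<in> closure Z" "w - y \<in> (closure Z)\<^sup>\<bottom>"
    using orthogonal_projection_exists[OF closure_of_subspace[OF Z(1)] closed_closure] .
  have "y \<in> horizontal_space A"
    using y(1) closure_minimal[OF Z(2)] closed_orthogonal_comp unfolding horizontal_space_def by blast
  then have "w - y \<in> horizontal_space A"
    using w subspace_orthogonal_comp unfolding horizontal_space_def by (intro subspace_diff)
  moreover have "inner z (w - y) = 0" if "z \<in> Z" for z
    using y(2) that closure_subset unfolding orthogonal_comp_def orthogonal_def by blast
  ultimately have "w - y = 0"
    by (rule sep)
  then show "w \<in> closure Z"
    using y(1) by simp
qed

section \<open>Smooth functions modulo constants\<close>

text \<open>
  Linearity holds only on \<open>W\<close>: outside, the derivatives need not exist.  Openness of \<open>W\<close> lets the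
  induction hypothesis, an identity on \<open>W\<close>, be differentiated.
\<close>

lemma iterated_partial_linear:
  assumes W: "open W" and f: "smooth_on W f" and h: "smooth_on W h" and "x \<in> W"
  shows "iterated_partial is (\<lambda>x. a * f x + b * h x) x =
    a * iterated_partial is f x + b * iterated_partial is h x"
  using \<open>x \<in> W\<close>
proof (induction "is" arbitrary: x)
  case (Cons i "is")
  let ?F = "iterated_partial is f" and ?H = "iterated_partial is h"
  have "?F differentiable (at x)" "?H differentiable (at x)"
    using f h W Cons.prems unfolding smooth_on_def
    by (auto simp: differentiable_on_eq_differentiable_at)
  then have "((\<lambda>x. a * ?F x + b * ?H x) has_derivative
      (\<lambda>v. a * frechet_derivative ?F (at x) v + b * frechet_derivative ?H (at x) v)) (at x)"
    by (auto intro!: derivative_eq_intros simp: frechet_derivative_works)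
  then have "(iterated_partial is (\<lambda>x. a * f x + b * h x) has_derivative
      (\<lambda>v. a * frechet_derivative ?F (at x) v + b * frechet_derivative ?H (at x) v)) (at x)"
    by (rule has_derivative_transform_within_open[OF _ W Cons.prems]) (simp add: Cons.IH)
  from frechet_derivative_at[OF this, symmetric] show ?case
    by simp
qed simp

lemma smooth_on_linear:
  assumes W: "open W" and f: "smooth_on W f" and h: "smooth_on W h"
  shows "smooth_on W (\<lambda>x. a * f x + b * h x)"
  unfolding smooth_on_def
proof
  fix "is"
  have "(\<lambda>x. a * iterated_partial is f x + b * iterated_partial is h x) differentiable_on W"
    using f h unfolding smooth_on_def by (intro derivative_intros) auto
  then show "iterated_partial is (\<lambda>x. a * f x + b * h x) differentiable_on W"
    unfolding differentiable_on_def
    by (auto intro: differentiable_transform_within[OF _ zero_less_one]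
        simp: iterated_partial_linear[OF assms])
qed

lemma smooth_on_const: "smooth_on W (\<lambda>_. c)"
proof -
  have "iterated_partial is (\<lambda>_. c) = (\<lambda>_. if is = [] then c else 0)" for "is" :: "'a::finite list"
    by (induction "is") auto
  then show ?thesis
    by (simp add: smooth_on_def)
qed

lemma smooth_functions_linear:
  assumes "oriented_atlas At" "f \<in> smooth_functions At" "h \<in> smooth_functions At"
  shows "(\<lambda>x. a * f x + b * h x) \<in> smooth_functions At"
  using assms smooth_on_linear
  by (fastforce simp: smooth_functions_def oriented_atlas_def is_chart_def comp_def)

lemma smooth_functions_const: "(\<lambda>_. c) \<in> smooth_functions At"
  by (simp add: smooth_functions_def comp_def smooth_on_const)

lemma smooth_function_vector_space:
  assumes "oriented_atlas At"
  shows "vector_space_axioms (smooth_function_space At)"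
  using smooth_functions_linear[OF assms, of _ _ 1 1] smooth_functions_linear[OF assms, of _ _ _ 0]
  by (auto simp: vector_space_axioms_def smooth_function_space_def smooth_functions_const
      algebra_simps)

lemma constants_linear_subspace: "linear_subspace (smooth_function_space At) {\<lambda>_. c | c. True}"
  by (auto simp: linear_subspace_def smooth_function_space_def smooth_functions_const)

text \<open>
  The Leibniz rule for \<open>1 = 1 \<cdot> 1\<close> gives \<open>\<delta> 1 = 2 \<delta> 1\<close>.
\<close>

lemma tangent_space_const:
  assumes "\<delta> \<in> tangent_space At p"
  shows "\<delta> (\<lambda>_. c) = 0"
proof -
  have one: "(\<lambda>_. 1) \<in> smooth_functions At"
    by (rule smooth_functions_const)
  have leibniz: "\<delta> (\<lambda>x. f x * h x) = f p * \<delta> h + \<delta> f * h p"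
    and linear: "\<delta> (\<lambda>x. a * f x + b * h x) = a * \<delta> f + b * \<delta> h"
    if "f \<in> smooth_functions At" "h \<in> smooth_functions At" for f h a b
    using assms that by (simp_all add: tangent_space_def)
  have "\<delta> (\<lambda>_. 1) = 0"
    using leibniz[OF one one] by simp
  then show ?thesis
    using linear[OF one one, of c 0] by simp
qed

lemma gradient_const:
  assumes g: "riemannian_metric At g"
  shows "gradient At g (\<lambda>_. c) = (\<lambda>_ _. 0)"
proof
  fix p
  have zero: "(\<lambda>_. 0) \<in> tangent_space At p"
    by (simp add: tangent_space_def)
  have g0: "g p (\<lambda>_. 0) u = 0" if u: "u \<in> tangent_space At p" for u
  proof -
    have "g p (\<lambda>f. 0 * u f + 0 * u f) u = 0 * g p u u + 0 * g p u u"
      using g u unfolding riemannian_metric_def by blast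
    then show ?thesis
      by simp
  qed
  show "gradient At g (\<lambda>_. c) p = (\<lambda>_. 0)"
    unfolding gradient_def
  proof (rule the_equality)
    fix w
    assume "w \<in> tangent_space At p \<and> (\<forall>u\<in>tangent_space At p. g p w u = u (\<lambda>_. c))"
    then have "w \<in> tangent_space At p" "g p w w = 0"
      by (auto simp: tangent_space_const)
    then show "w = (\<lambda>_. 0)"
      using g unfolding riemannian_metric_def by (metis less_irrefl)
  qed (simp add: zero g0 tangent_space_const)
qed

lemma distributional_field_zero:
  assumes "T \<in> distributional_fields At"
  shows "T (\<lambda>_ _. 0) = 0"
proof (cases "(\<lambda>_ _. 0) \<in> smooth_fields At")
  case True
  have "T (\<lambda>p f. a * X p f + b * Y p f) = a * T X + b * T Y"
    if "X \<in> smooth_fields At" "Y \<in> smooth_fields At" for X Y a b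
    using assms that by (simp add: distributional_fields_def)
  from this[OF True True, of 0 0] show ?thesis
    by simp
qed (use assms in \<open>simp add: distributional_fields_def\<close>)

text \<open>
  This makes the pairing a function of the covector, not of the representing function.
\<close>

lemma weighted_pairing_const:
  assumes "riemannian_metric At g" "T \<in> distributional_fields At"
  shows "weighted_pairing At g \<rho> (\<lambda>_. c) T = 0"
  by (simp add: weighted_pairing_def gradient_const[OF assms(1)] distributional_field_zero[OF assms(2)])

lemma continuity_operator_smooth:
  "\<phi> \<in> smooth_functions At \<Longrightarrow>
    continuity_operator At g \<rho> \<iota> v \<phi> = weighted_pairing At g \<rho> \<phi> (\<iota> v)"
  by (simp add: continuity_operator_def divergence_def field_mult_def weighted_pairing_def)

lemma continuity_operator_linear:
  assumes "hilbert_space_of_fields At \<iota>"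
  shows "continuity_operator At g \<rho> \<iota> (a *\<^sub>R v + b *\<^sub>R w) =
    (\<lambda>\<phi>. a * continuity_operator At g \<rho> \<iota> v \<phi> + b * continuity_operator At g \<rho> \<iota> w \<phi>)"
proof -
  have "\<iota> (a *\<^sub>R v + b *\<^sub>R w) = (\<lambda>X. a * \<iota> v X + b * \<iota> w X)"
    using assms by (simp add: hilbert_space_of_fields_def)
  then show ?thesis
    by (auto simp: continuity_operator_def divergence_def field_mult_def fun_eq_iff algebra_simps)
qed

lemma regular_covector_memD:
  assumes at: "oriented_atlas At" and f: "f \<in> vcarrier (regular_covectors At)"
  shows "f \<noteq> {}" and "\<phi> \<in> f \<Longrightarrow> \<phi> \<in> smooth_functions At"
    and "\<lbrakk>\<phi> \<in> f; \<psi> \<in> f\<rbrakk> \<Longrightarrow> \<exists>c. \<psi> = (\<lambda>x. \<phi> x + c)"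
proof -
  let ?S = "smooth_function_space At"
  obtain \<eta> where \<eta>: "\<eta> \<in> vcarrier ?S" and eq: "f = coset ?S {\<lambda>_. c | c. True} \<eta>"
    using f by (auto simp: regular_covectors_def quotient_vspace_def)
  note vs = smooth_function_vector_space[OF at] constants_linear_subspace
  show "f \<noteq> {}"
    using self_in_coset[OF vs \<eta>] eq by blast
  show "\<phi> \<in> f \<Longrightarrow> \<phi> \<in> smooth_functions At"
    using coset_subset_carrier[OF vs \<eta>] eq by (auto simp: smooth_function_space_def)
  have shift: "\<exists>c. \<phi> = (\<lambda>x. \<eta> x + c)" if "\<phi> \<in> f" for \<phi>
    using that unfolding eq coset_def by (auto simp: smooth_function_space_def)
  show "\<exists>c. \<psi> = (\<lambda>x. \<phi> x + c)" if mem: "\<phi> \<in> f" "\<psi> \<in> f"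
  proof -
    obtain c d where "\<phi> = (\<lambda>x. \<eta> x + c)" "\<psi> = (\<lambda>x. \<eta> x + d)"
      using shift[OF mem(1)] shift[OF mem(2)] by blast
    then have "\<psi> = (\<lambda>x. \<phi> x + (d - c))"
      by auto
    then show ?thesis ..
  qed
qed

lemma distribution_linear:
  assumes "\<sigma> \<in> distributions At" "\<phi> \<in> smooth_functions At" "\<psi> \<in> smooth_functions At"
  shows "\<sigma> (\<lambda>x. a * \<phi> x + b * \<psi> x) = a * \<sigma> \<phi> + b * \<sigma> \<psi>"
  using assms by (simp add: distributions_def)

text \<open>
  \<open>\<langle>B f, v\<rangle> = (A v) \<phi>\<close> for any representative \<open>\<phi>\<close> of \<open>f\<close>, and the distribution \<open>A v\<close> is linear in
  \<open>\<phi>\<close>; hence \<open>B\<close> is linear in \<open>f\<close>.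
\<close>

lemma riesz_isometric_linear_map:
  fixes B :: "'m::topological_space covector \<Rightarrow> 'v::real_inner"
  assumes at: "oriented_atlas (At :: ('m, 'n::finite) chart set)"
    and dist: "\<And>v. A v \<in> distributions At"
    and C: "linear_subspace (regular_covectors At) C"
    and B: "\<And>f \<phi> v. \<lbrakk>f \<in> C; \<phi> \<in> f\<rbrakk> \<Longrightarrow> inner (B f) v = A v \<phi>"
  shows "isometric_linear_map (covector_form_space At C B) B"
proof -
  let ?R = "regular_covectors At"
  have CR: "f \<in> vcarrier ?R" if "f \<in> C" for f
    using C that by (auto simp: linear_subspace_def)
  have closed: "vzero ?R \<in> C" "\<And>f h. \<lbrakk>f \<in> C; h \<in> C\<rbrakk> \<Longrightarrow> vadd ?R f h \<in> C"
    "\<And>a f. f \<in> C \<Longrightarrow> vscale ?R a f \<in> C"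
    using C by (auto simp: linear_subspace_def)
  have lin: "B k = a *\<^sub>R B f + b *\<^sub>R B h"
    if k: "f \<in> C" "h \<in> C" "k \<in> C" "\<phi> \<in> f" "\<psi> \<in> h" "(\<lambda>x. a * \<phi> x + b * \<psi> x) \<in> k"
    for f h k \<phi> \<psi> a b
  proof -
    have "inner (B k) v = inner (a *\<^sub>R B f + b *\<^sub>R B h) v" for v
      using k B distribution_linear[OF dist] regular_covector_memD(2)[OF at CR]
      by (simp add: inner_add_left)
    then show ?thesis
      using vector_eq_rdot by blast
  qed
  have add: "B (vadd ?R f h) = B f + B h" if fh: "f \<in> C" "h \<in> C" for f h
  proof -
    obtain \<phi> \<psi> where e: "\<phi> \<in> f" "\<psi> \<in> h"
      using regular_covector_memD(1)[OF at CR] fh by blast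
    then have "(\<lambda>x. 1 * \<phi> x + 1 * \<psi> x) \<in> vadd ?R f h"
      by (auto simp: regular_covectors_def quotient_vspace_def smooth_function_space_def)
    from lin[OF fh closed(2)[OF fh] e this] show ?thesis
      by simp
  qed
  have scale: "B (vscale ?R a f) = a *\<^sub>R B f" if f: "f \<in> C" for a f
  proof -
    obtain \<phi> where e: "\<phi> \<in> f"
      using regular_covector_memD(1)[OF at CR] f by blast
    have "(\<lambda>x. a * \<phi> x + 0 * \<phi> x) \<in> vscale ?R a f"
      using e by (force simp: regular_covectors_def quotient_vspace_def smooth_function_space_def)
    from lin[OF f f closed(3)[OF f] e e this] show ?thesis
      by simp
  qed
  have z: "(\<lambda>_. 0) \<in> vzero ?R"
    by (auto simp: regular_covectors_def quotient_vspace_def)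
  have "B (vzero ?R) = 0"
    using lin[OF closed(1) closed(1) closed(1) z z, of 0 0] z by simp
  then show ?thesis
    unfolding isometric_linear_map_def covector_form_space_def
    by (simp add: closed add scale)
qed

theorem proposition4p1:
  fixes At :: "('m::{t2_space, second_countable_topology}, 'n::finite) chart set"
    and g :: "'m metric_tensor"
    and \<rho> :: "'m \<Rightarrow> real"
    and \<iota> :: "'v::{real_inner, complete_space} \<Rightarrow> 'm dist_field"
    and C :: "'m covector set"
  fixes A :: "'v \<Rightarrow> 'm dist"
    and B :: "'m covector \<Rightarrow> 'v"
    and K :: "'m covector \<Rightarrow> 'm dist"
  defines "A \<equiv> continuity_operator At g \<rho> \<iota>"
    and "B \<equiv> riesz_representative At g \<rho> \<iota>"
    and "K \<equiv> (\<lambda>f. A (B f))"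
  assumes manifold: "closed_oriented_riemannian_manifold At g"
    and density: "\<rho> \<in> smooth_positive_densities At g"
    and hilbert: "hilbert_space_of_fields At \<iota>"
    and A_distribution: "\<forall>v. A v \<in> distributions At"
    and A_continuous: "continuous_on UNIV A"
    and covectors: "linear_subspace (regular_covectors At) C"
    and covectors_continuous:
      "\<forall>f\<in>C. \<forall>\<phi>\<in>f. continuous_on UNIV (\<lambda>v. weighted_pairing At g \<rho> \<phi> (\<iota> v))"
  shows "positive_semidefinite_form (covector_form_space At C B) \<and>
    is_hilbert_space (cotangent_space At C B) \<and>
    A ` closure (B ` C) \<subseteq> range A \<and>
    (\<forall>f\<in>C. \<forall>h\<in>C. \<forall>\<phi>\<in>f. K h \<phi> = inner (B f) (B h)) \<and>
    (\<exists>L. isometric_isomorphism (cotangent_space At C B) (A ` closure (B ` C)) (tangent_norm A) L \<and>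
         (\<forall>f\<in>C. L (covector_embed At C B f) = K f) \<and>
         (\<forall>L'. isometric_isomorphism (cotangent_space At C B) (A ` closure (B ` C))
                  (tangent_norm A) L' \<and>
               (\<forall>f\<in>C. L' (covector_embed At C B f) = K f) \<longrightarrow>
               (\<forall>x\<in>vcarrier (cotangent_space At C B). L' x = L x)) \<and>
         ((\<forall>w\<in>horizontal_space A.
             (\<forall>f\<in>C. \<forall>\<phi>\<in>f. weighted_pairing At g \<rho> \<phi> (\<iota> w) = 0) \<longrightarrow> w = 0) \<longrightarrow>
          B ` C \<subseteq> horizontal_space A \<and> horizontal_space A \<subseteq> closure (B ` C) \<and>
          L ` vcarrier (cotangent_space At C B) = range A))"
proof -
  have at: "oriented_atlas At" and metric: "riemannian_metric At g"
    using manifold by (simp_all add: closed_oriented_riemannian_manifold_def)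
  have CR: "f \<in> vcarrier (regular_covectors At)" if "f \<in> C" for f
    using covectors that by (auto simp: linear_subspace_def)
  note mem = regular_covector_memD[OF at CR]
  have pair: "weighted_pairing At g \<rho> \<phi> (\<iota> v) = A v \<phi>" if "f \<in> C" "\<phi> \<in> f" for f \<phi> v
    unfolding A_def using mem(2)[OF that] by (simp add: continuity_operator_smooth)
  have lin: "A (a *\<^sub>R v + b *\<^sub>R w) = (\<lambda>\<phi>. a * A v \<phi> + b * A w \<phi>)" for a b v w
    unfolding A_def by (rule continuity_operator_linear[OF hilbert])
  have const: "A v (\<lambda>_. c) = 0" for v c
    using hilbert weighted_pairing_const[OF metric]
    by (simp add: A_def continuity_operator_smooth smooth_functions_const hilbert_space_of_fields_def)
  \<comment> \<open>Representatives of a covector differ by constants, on which \<open>A v\<close> vanishes.\<close>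
  have same: "A v \<psi> = A v \<phi>" if f: "f \<in> C" "\<phi> \<in> f" "\<psi> \<in> f" for f \<phi> \<psi> v
  proof -
    obtain c where "\<psi> = (\<lambda>x. 1 * \<phi> x + 1 * (\<lambda>_. c) x)"
      using mem(3)[OF f] by auto
    then show ?thesis
      using distribution_linear[OF A_distribution[rule_format] mem(2)[OF f(1,2)]
          smooth_functions_const, of v 1 1 c] const by simp
  qed
  \<comment> \<open>The definite description in \<open>B\<close> denotes: Riesz gives existence, nondegeneracy uniqueness.\<close>
  have B: "inner (B f) v = A v \<phi>" if f: "f \<in> C" "\<phi> \<in> f" for f \<phi> v
  proof -
    have "linear (\<lambda>v. A v \<phi>)"
      by (rule linearI) (simp_all add: pointwise_linear_simps[OF lin])
    moreover have "continuous_on UNIV (\<lambda>v. A v \<phi>)"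
      using covectors_continuous f by (simp add: pair)
    ultimately obtain b where b: "\<And>v. inner b v = A v \<phi>"
      by (rule riesz_representation_exists) blast
    have "inner b v = weighted_pairing At g \<rho> \<psi> (\<iota> v)" if "\<psi> \<in> f" for \<psi> v
      by (simp only: pair[OF f(1) that] same[OF f that] b)
    moreover have "b' = b"
      if "\<forall>\<psi>\<in>f. \<forall>v. inner b' v = weighted_pairing At g \<rho> \<psi> (\<iota> v)" for b'
    proof -
      have "inner b' v = inner b v" for v
        using that f(2) by (simp add: pair[OF f] b)
      then show ?thesis
        using vector_eq_rdot by blast
    qed
    ultimately have "B f = b"
      unfolding B_def riesz_representative_def by (intro the_equality) blast+
    then show ?thesis
      by (simp only: b)
  qed

  let ?S = "covector_form_space At C B" and ?N = "form_kernel C B"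
  let ?Q = "covector_quotient At C B" and ?T = "cotangent_space At C B"
  have car: "vcarrier ?S = C"
    by (simp add: covector_form_space_def)
  have isoS: "isometric_linear_map ?S B"
    by (rule riesz_isometric_linear_map[OF at A_distribution[rule_format] covectors B])
  have vsS: "vector_space_axioms ?S"
    unfolding covector_form_space_def vector_space_with_form regular_covectors_def
    by (intro vector_space_on_subspace quotient_vector_space smooth_function_vector_space[OF at]
        constants_linear_subspace covectors[unfolded regular_covectors_def])
  have N: "?N = {f \<in> vcarrier ?S. B f = 0}"
    by (simp add: form_kernel_def car)
  note quot = vsS isoS N
  define \<Lambda> where "\<Lambda> = map_on_completion (map_on_quotient B)"
  have isoQ: "isometric_linear_map ?Q (map_on_quotient B)"
    and injQ: "inj_on (map_on_quotient B) (vcarrier ?Q)"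
    and imQ: "map_on_quotient B ` vcarrier ?Q = B ` C"
    unfolding covector_quotient_def
    by (rule quotient_isometric_linear_map[OF quot], rule map_on_quotient_inj[OF quot],
        simp only: map_on_quotient_image[OF quot] car)
  have isoT: "isometric_linear_map ?T \<Lambda>" and injT: "inj_on \<Lambda> (vcarrier ?T)"
    and imT: "\<Lambda> ` vcarrier ?T = closure (B ` C)" and hilbT: "is_hilbert_space ?T"
    unfolding cotangent_space_def \<Lambda>_def
    using completion_isometric_linear_map[OF isoQ injQ] map_on_completion_inj[OF isoQ injQ]
      map_on_completion_image[OF isoQ injQ] completion_hilbert[OF isoQ injQ] imQ by simp_all
  have embed: "covector_embed At C B f \<in> vcarrier ?T \<and> \<Lambda> (covector_embed At C B f) = B f"
    if "f \<in> C" for f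
  proof -
    have "coset ?S ?N f \<in> vcarrier ?Q"
      using that by (simp add: covector_quotient_def quotient_carrier[OF quot] car)
    then show ?thesis
      using completion_embed_isometric[OF isoQ injQ] map_on_quotient_coset[OF quot] that
      by (simp add: covector_embed_def cotangent_space_def \<Lambda>_def car)
  qed

  \<comment> \<open>If \<open>A v = 0\<close> then \<open>inner (B f) v = A v \<phi> = 0\<close>.\<close>
  have BC_horizontal: "B ` C \<subseteq> horizontal_space A"
    using B mem(1) by (fastforce simp: horizontal_space_def kernel_space_def orthogonal_comp_def
        orthogonal_def inner_commute)
  then have horizontal: "\<Lambda> ` vcarrier ?T \<subseteq> horizontal_space A"
    unfolding imT using closed_orthogonal_comp[of "kernel_space A"]
    by (auto simp: horizontal_space_def dest: closure_minimal)
  let ?L = "\<lambda>x. A (\<Lambda> x)"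
  have iso: "isometric_isomorphism ?T (A ` closure (B ` C)) (tangent_norm A) ?L"
    using horizontal_isometric_isomorphism[OF lin isoT horizontal injT] by (simp add: imT)
  have extends: "\<forall>f\<in>C. ?L (covector_embed At C B f) = K f"
    using embed by (simp add: K_def)
  have unique: "L' x = ?L x"
    if L': "isometric_isomorphism ?T (A ` closure (B ` C)) (tangent_norm A) L'"
      "\<forall>f\<in>C. L' (covector_embed At C B f) = K f" and x: "x \<in> vcarrier ?T" for L' x
  proof (rule isometric_isomorphism_unique[OF lin isoT horizontal, of _ "covector_embed At C B ` C"])
    have "\<Lambda> ` covector_embed At C B ` C = B ` C"
      unfolding image_image using embed by (intro image_cong) auto
    then show "\<Lambda> ` vcarrier ?T \<subseteq> closure (\<Lambda> ` covector_embed At C B ` C)"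
      by (simp add: imT)
  qed (use L' x embed imT extends in auto)
  have onto: "horizontal_space A \<subseteq> closure (B ` C) \<and> ?L ` vcarrier ?T = range A"
    if sep: "\<forall>w\<in>horizontal_space A.
      (\<forall>f\<in>C. \<forall>\<phi>\<in>f. weighted_pairing At g \<rho> \<phi> (\<iota> w) = 0) \<longrightarrow> w = 0"
  proof -
    have "subspace (B ` C)"
      using isoS unfolding isometric_linear_map_def car
      by (intro subspaceI) (auto simp: image_iff, metis+)
    then have H: "horizontal_space A \<subseteq> closure (B ` C)"
      using BC_horizontal
    proof (rule horizontal_subset_closure)
      fix w assume w: "w \<in> horizontal_space A" "\<And>z. z \<in> B ` C \<Longrightarrow> inner z w = 0"
      have "\<forall>f\<in>C. \<forall>\<phi>\<in>f. weighted_pairing At g \<rho> \<phi> (\<iota> w) = 0"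
        using w(2) B by (metis pair imageI)
      then show "w = 0"
        using sep w(1) by blast
    qed
    have "range A = A ` horizontal_space A"
      using orthogonal_projection_exists[OF subspace_kernel_space[OF lin]
          closed_kernel_space[OF lin A_continuous]]
      unfolding horizontal_space_def[symmetric]
      by (intro range_eq_image_horizontal[OF lin]) metis
    moreover have "?L ` vcarrier ?T = A ` closure (B ` C)"
      by (simp add: imT flip: image_image)
    ultimately show ?thesis
      using H horizontal imT by auto
  qed
  show ?thesis
    using isometric_linear_map_semidefinite[OF isoS] hilbT B BC_horizontal onto iso extends unique
    by (intro conjI exI[of _ ?L]) (auto simp: K_def)
qed

end
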